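(* Let $r\ge 2$, $t\ge 1$ be fixed integers and let $f_i= g_{i1}*\cdots *g_{it}$ $(1\le i\le r)$, where $g_{ij}:\mathbb{N}\to\mathbb{C}$ are nonzero completely multiplicative functions $(1\le i\le r,\ 1\le j\le t)$. Then (formally or in the case of absolute convergence) $$\sum_{\substack{n_1,\ldots,n_r=1\\ \gcd(n_1,\ldots,n_r)=1}}^{\infty} \frac{f_1(n_1)\cdots f_r(n_r)}{n_1^{s_1}\cdots n_r^{s_r}} = D(f_1,s_1)\cdots D(f_r,s_r)\, \Delta(f_1,\ldots,f_r,s_1,\ldots,s_r),$$ where $$\Delta(f_1,\ldots,f_r,s_1,\ldots,s_r) = \prod_p \Bigl(1+ (-1)^{r-1} \sum_{1\le a_1,\ldots,a_r\le t} \frac1{p^{a_1s_1+\cdots +a_rs_r}} \prod_{i=1}^r (-1)^{a_i} G_{i a_i}(p)\Bigr),$$ the product being over all primes $p$, and $$G_{ij}(p):= \sum_{1\le \ell_1<\cdots <\ell_j\le t} g_{i\ell_1}(p)\cdots g_{i\ell_j}(p)\qquad (1\le i\le r,\ 1\le j\le t,\ p \text{ prime}).$$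
   Context: $\mathbb{N}=\{1,2,\ldots\}$. For $f,g:\mathbb{N}\to\mathbb{C}$, $(f*g)(n)=\sum_{d\mid n} f(d)g(n/d)$ is the Dirichlet convolution. A nonzero function $f:\mathbb{N}\to\mathbb{C}$ is completely multiplicative if $f(mn)=f(m)f(n)$ for all $m,n\in\mathbb{N}$. $D(f,s)=\sum_{n=1}^\infty f(n)n^{-s}$ is the Dirichlet series of $f$. "Formally or in the case of absolute convergence" means: the identity holds as an identity of formal Dirichlet series in $s_1,\ldots,s_r$ (with formal Euler products), and it holds as an identity of complex numbers at all $(s_1,\ldots,s_r)\in\mathbb{C}^r$ for which the Dirichlet series and Euler products occurring in it converge absolutely. *)

theory Defs
  imports "HOL-Analysis.Analysis" "HOL-Computational_Algebra.Primes"
begin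

section \<open>Arithmetic functions\<close>

text \<open>
  Arithmetic functions on the positive integers are represented as functions on \<^typ>\<open>nat\<close> whose
  value at \<open>0\<close> is irrelevant.
\<close>

definition completely_multiplicative :: "(nat \<Rightarrow> complex) \<Rightarrow> bool" where
  "completely_multiplicative f \<longleftrightarrow>
     (\<exists>n\<ge>1. f n \<noteq> 0) \<and> (\<forall>m\<ge>1. \<forall>n\<ge>1. f (m * n) = f m * f n)"

definition dirichlet_conv :: "(nat \<Rightarrow> complex) \<Rightarrow> (nat \<Rightarrow> complex) \<Rightarrow> nat \<Rightarrow> complex" where
  "dirichlet_conv f g n = (\<Sum>d | d dvd n. f d * g (n div d))"

text \<open>\<open>dirichlet_conv_upto g t\<close> is \<open>g 1 * \<dots> * g t\<close>; the empty convolution is the unit.\<close>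

primrec dirichlet_conv_upto :: "(nat \<Rightarrow> nat \<Rightarrow> complex) \<Rightarrow> nat \<Rightarrow> nat \<Rightarrow> complex" where
  "dirichlet_conv_upto g 0 = (\<lambda>n. if n = 1 then 1 else 0)"
| "dirichlet_conv_upto g (Suc t) = dirichlet_conv (dirichlet_conv_upto g t) (g (Suc t))"

text \<open>
  \<open>G g t j p\<close> is the sum of \<open>g l\<^sub>1 p \<cdots> g l\<^sub>j p\<close> over all \<open>1 \<le> l\<^sub>1 < \<dots> < l\<^sub>j \<le> t\<close>; such an
  increasing tuple is given by its set of entries.
\<close>

definition G :: "(nat \<Rightarrow> nat \<Rightarrow> complex) \<Rightarrow> nat \<Rightarrow> nat \<Rightarrow> nat \<Rightarrow> complex" where
  "G g t j p = (\<Sum>L | L \<subseteq> {1..t} \<and> card L = j. \<Prod>l\<in>L. g l p)"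


section \<open>Analytic Dirichlet series and Euler product\<close>

text \<open>
  The \<open>r\<close> variables are indexed by a finite type \<open>'r\<close> with \<open>r = CARD('r)\<close>.
\<close>

definition coprime_tuples :: "('r::finite \<Rightarrow> nat) set" where
  "coprime_tuples = {n. (\<forall>i. n i \<ge> 1) \<and> Gcd (range n) = 1}"

definition D_term :: "(nat \<Rightarrow> complex) \<Rightarrow> complex \<Rightarrow> nat \<Rightarrow> complex" where
  "D_term f s n = f n / of_nat n powr s"

definition D :: "(nat \<Rightarrow> complex) \<Rightarrow> complex \<Rightarrow> complex" where
  "D f s = (\<Sum>\<^sub>\<infinity>n\<in>{1..}. D_term f s n)"

definition multi_term :: "('r::finite \<Rightarrow> nat \<Rightarrow> complex) \<Rightarrow> ('r \<Rightarrow> complex) \<Rightarrow> ('r \<Rightarrow> nat) \<Rightarrow> complex" where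
  "multi_term f s n = (\<Prod>i\<in>UNIV. f i (n i)) / (\<Prod>i\<in>UNIV. of_nat (n i) powr s i)"

definition Delta_factor ::
    "('r::finite \<Rightarrow> nat \<Rightarrow> nat \<Rightarrow> complex) \<Rightarrow> nat \<Rightarrow> ('r \<Rightarrow> complex) \<Rightarrow> nat \<Rightarrow> complex" where
  "Delta_factor g t s p =
     1 + (-1) ^ (CARD('r) - 1) *
       (\<Sum>a | \<forall>i. a i \<in> {1..t}.
          1 / of_nat p powr (\<Sum>i\<in>UNIV. of_nat (a i) * s i) *
          (\<Prod>i\<in>UNIV. (-1) ^ a i * G (g i) t (a i) p))"

text \<open>Products over the primes are products over all \<open>p\<close> with factor \<open>1\<close> at the nonprimes.\<close>

definition Delta_seq ::
    "('r::finite \<Rightarrow> nat \<Rightarrow> nat \<Rightarrow> complex) \<Rightarrow> nat \<Rightarrow> ('r \<Rightarrow> complex) \<Rightarrow> nat \<Rightarrow> complex" where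
  "Delta_seq g t s p = (if prime p then Delta_factor g t s p else 1)"

definition Delta :: "('r::finite \<Rightarrow> nat \<Rightarrow> nat \<Rightarrow> complex) \<Rightarrow> nat \<Rightarrow> ('r \<Rightarrow> complex) \<Rightarrow> complex" where
  "Delta g t s = prodinf (Delta_seq g t s)"


section \<open>The ring of formal Dirichlet series in several variables\<close>

text \<open>
  An element of \<open>'r mds\<close> is a formal series \<open>\<Sum>n. F n / \<Prod>i. n i powr s i\<close> over the tuples \<open>n\<close> of
  positive integers, given by its coefficients \<open>F\<close>, which are set to \<open>0\<close> outside these tuples.
\<close>

typedef (overloaded) 'r mds =
    "{F :: ('r::finite \<Rightarrow> nat) \<Rightarrow> complex. \<forall>n. (\<exists>i. n i = 0) \<longrightarrow> F n = 0}"
  morphisms mds_coeff Abs_mds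
  by (rule exI[of _ "\<lambda>_. 0"]) simp

definition Mds :: "(('r::finite \<Rightarrow> nat) \<Rightarrow> complex) \<Rightarrow> 'r mds" where
  "Mds F = Abs_mds (\<lambda>n. if \<forall>i. n i \<ge> 1 then F n else 0)"

lemma mds_coeff_Mds: "mds_coeff (Mds F) n = (if \<forall>i. n i \<ge> 1 then F n else 0)"
proof -
  have "(\<lambda>n. if \<forall>i. n i \<ge> 1 then F n else 0) \<in> {F. \<forall>n. (\<exists>i. n i = 0) \<longrightarrow> F n = 0}"
    by (auto simp: Suc_le_eq) (metis less_irrefl)
  then show ?thesis unfolding Mds_def by (subst Abs_mds_inverse) auto
qed

lemma mds_coeff_nonpos: "\<exists>i. n i = 0 \<Longrightarrow> mds_coeff F n = 0"
  using mds_coeff[of F] by blast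

lemma mds_eqI:
  assumes "\<And>n. (\<And>i. n i \<ge> 1) \<Longrightarrow> mds_coeff F n = mds_coeff H n"
  shows "F = H"
proof -
  have "mds_coeff F n = mds_coeff H n" for n
  proof (cases "\<exists>i. n i = 0")
    case True
    then show ?thesis by (simp add: mds_coeff_nonpos)
  next
    case False
    then show ?thesis by (intro assms) (simp add: Suc_le_eq)
  qed
  then show ?thesis by (simp add: mds_coeff_inject[symmetric] fun_eq_iff)
qed

abbreviation mult_pairs :: "('r \<Rightarrow> nat) \<Rightarrow> (('r \<Rightarrow> nat) \<times> ('r \<Rightarrow> nat)) set" where
  "mult_pairs n \<equiv> {(d, e). (\<lambda>i. d i * e i) = n}"

lemma finite_mult_pairs:
  fixes n :: "'r::finite \<Rightarrow> nat"
  assumes "\<And>i. n i \<ge> 1"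
  shows "finite (mult_pairs n)"
proof -
  have fin: "finite (Pi\<^sub>E UNIV (\<lambda>i. {d. d dvd n i}))"
    using assms by (intro finite_PiE) (auto simp: Suc_le_eq)
  have "mult_pairs n \<subseteq> Pi\<^sub>E UNIV (\<lambda>i. {d. d dvd n i}) \<times> Pi\<^sub>E UNIV (\<lambda>i. {d. d dvd n i})"
    by (auto simp: PiE_def)
  then show ?thesis by (rule finite_subset) (use fin in simp)
qed

instantiation mds :: (finite) comm_ring_1
begin

definition zero_mds :: "'a mds" where "0 = Mds (\<lambda>_. 0)"
definition one_mds :: "'a mds" where "1 = Mds (\<lambda>n. if \<forall>i. n i = 1 then 1 else 0)"
definition plus_mds :: "'a mds \<Rightarrow> 'a mds \<Rightarrow> 'a mds" where
  "F + H = Mds (\<lambda>n. mds_coeff F n + mds_coeff H n)"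
definition uminus_mds :: "'a mds \<Rightarrow> 'a mds" where
  "- F = Mds (\<lambda>n. - mds_coeff F n)"
definition minus_mds :: "'a mds \<Rightarrow> 'a mds \<Rightarrow> 'a mds" where
  "F - H = Mds (\<lambda>n. mds_coeff F n - mds_coeff H n)"
definition times_mds :: "'a mds \<Rightarrow> 'a mds \<Rightarrow> 'a mds" where
  "F * H = Mds (\<lambda>n. \<Sum>(d, e)\<in>mult_pairs n. mds_coeff F d * mds_coeff H e)"

instance
proof
  fix F H K :: "'a mds"
  show "F + H + K = F + (H + K)" "F + H = H + F" "0 + F = F" "- F + F = 0" "F - H = F + - H"
    by (rule mds_eqI; simp add: plus_mds_def zero_mds_def uminus_mds_def minus_mds_def mds_coeff_Mds)+
  show "F * H = H * F"
  proof (rule mds_eqI)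
    fix n :: "'a \<Rightarrow> nat" assume n: "\<And>i. n i \<ge> 1"
    have "(\<Sum>(d, e)\<in>mult_pairs n. mds_coeff F d * mds_coeff H e) =
          (\<Sum>(d, e)\<in>mult_pairs n. mds_coeff H d * mds_coeff F e)"
      by (rule sum.reindex_bij_witness[of _ prod.swap prod.swap]) (auto simp: mult.commute)
    then show "mds_coeff (F * H) n = mds_coeff (H * F) n"
      using n by (simp add: times_mds_def mds_coeff_Mds)
  qed
  show "(F + H) * K = F * K + H * K"
  proof (rule mds_eqI)
    fix n :: "'a \<Rightarrow> nat" assume n: "\<And>i. n i \<ge> 1"
    have "(\<Sum>(d, e)\<in>mult_pairs n. mds_coeff (F + H) d * mds_coeff K e) =
          (\<Sum>(d, e)\<in>mult_pairs n. mds_coeff F d * mds_coeff K e + mds_coeff H d * mds_coeff K e)"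
    proof (rule sum.cong[OF refl], clarify)
      fix d e :: "'a \<Rightarrow> nat" assume "n = (\<lambda>i. d i * e i)"
      with n have "\<forall>i. d i \<ge> 1" by (auto simp: Suc_le_eq)
      then show "mds_coeff (F + H) d * mds_coeff K e =
                 mds_coeff F d * mds_coeff K e + mds_coeff H d * mds_coeff K e"
        by (simp add: plus_mds_def mds_coeff_Mds distrib_right)
    qed
    moreover have "mds_coeff (F * K + H * K) n = mds_coeff (F * K) n + mds_coeff (H * K) n"
      using n by (simp add: plus_mds_def mds_coeff_Mds)
    ultimately show "mds_coeff ((F + H) * K) n = mds_coeff (F * K + H * K) n"
      using n by (simp add: times_mds_def mds_coeff_Mds sum.distrib case_prod_beta)
  qed
  show "1 * F = F"
  proof (rule mds_eqI)
    fix n :: "'a \<Rightarrow> nat" assume n: "\<And>i. n i \<ge> 1"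
    have "(\<Sum>(d, e)\<in>mult_pairs n. mds_coeff 1 d * mds_coeff F e) =
          (\<Sum>(d, e)\<in>{(\<lambda>_. 1, n)}. mds_coeff 1 d * mds_coeff F e)"
    proof (rule sum.mono_neutral_right)
      show "\<forall>x\<in>mult_pairs n - {(\<lambda>_. 1, n)}. (case x of (d, e) \<Rightarrow> mds_coeff 1 d * mds_coeff F e) = 0"
      proof (rule ballI)
        fix x assume x: "x \<in> mult_pairs n - {(\<lambda>_. 1, n)}"
        obtain d e where de: "x = (d, e)" by (cases x)
        have "\<not> (\<forall>i. d i = 1)"
        proof
          assume "\<forall>i. d i = 1"
          then have "d = (\<lambda>_. 1)" by auto
          with x de show False by auto
        qed
        then show "(case x of (d, e) \<Rightarrow> mds_coeff 1 d * mds_coeff F e) = 0"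
          by (auto simp: de one_mds_def mds_coeff_Mds)
      qed
    qed (use n in \<open>simp_all add: finite_mult_pairs del: One_nat_def\<close>)
    then show "mds_coeff (1 * F) n = mds_coeff F n"
      using n by (simp add: times_mds_def mds_coeff_Mds one_mds_def)
  qed
  show "F * H * K = F * (H * K)"
  proof (rule mds_eqI)
    fix n :: "'a \<Rightarrow> nat" assume n: "\<And>i. n i \<ge> 1"
    have pos: "1 \<le> fst x i" "1 \<le> snd x i" if "x \<in> mult_pairs n" for x i
    proof -
      have "fst x i * snd x i = n i" using that by auto
      with n[of i] show "1 \<le> fst x i" "1 \<le> snd x i" by (cases "fst x i"; cases "snd x i"; simp)+
    qed
    have fin: "finite (mult_pairs n)" "\<And>x. x \<in> mult_pairs n \<Longrightarrow> finite (mult_pairs (fst x))"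
        "\<And>x. x \<in> mult_pairs n \<Longrightarrow> finite (mult_pairs (snd x))"
      by (rule finite_mult_pairs; use n pos in blast)+
    have "(\<Sum>(d, c)\<in>mult_pairs n. mds_coeff (F * H) d * mds_coeff K c) =
          (\<Sum>x\<in>mult_pairs n. \<Sum>y\<in>mult_pairs (fst x).
             mds_coeff F (fst y) * mds_coeff H (snd y) * mds_coeff K (snd x))"
      by (rule sum.cong[OF refl], use pos in
            \<open>simp add: times_mds_def mds_coeff_Mds sum_distrib_right case_prod_beta\<close>)
    also have "\<dots> = (\<Sum>z\<in>Sigma (mult_pairs n) (\<lambda>x. mult_pairs (fst x)).
             mds_coeff F (fst (snd z)) * mds_coeff H (snd (snd z)) * mds_coeff K (snd (fst z)))"
      by (subst sum.Sigma) (use fin in \<open>simp_all add: case_prod_beta\<close>)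
    also have "\<dots> = (\<Sum>z\<in>Sigma (mult_pairs n) (\<lambda>x. mult_pairs (snd x)).
             mds_coeff F (fst (fst z)) * (mds_coeff H (fst (snd z)) * mds_coeff K (snd (snd z))))"
      by (rule sum.reindex_bij_witness[of _
            "\<lambda>((a, d), (b, c)). (((\<lambda>i. a i * b i), c), (a, b))"
            "\<lambda>((d, c), (a, b)). ((a, (\<lambda>i. b i * c i)), (b, c))"])
         (auto simp: mult.assoc)
    also have "\<dots> = (\<Sum>x\<in>mult_pairs n. \<Sum>y\<in>mult_pairs (snd x).
             mds_coeff F (fst x) * (mds_coeff H (fst y) * mds_coeff K (snd y)))"
      by (subst sum.Sigma) (use fin in \<open>simp_all add: case_prod_beta\<close>)
    also have "\<dots> = (\<Sum>(d, c)\<in>mult_pairs n. mds_coeff F d * mds_coeff (H * K) c)"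
      by (rule sum.cong[OF refl], use pos in
            \<open>simp add: times_mds_def mds_coeff_Mds sum_distrib_left case_prod_beta\<close>)
    finally show "mds_coeff (F * H * K) n = mds_coeff (F * (H * K)) n"
      using n by (simp add: times_mds_def[of "F * H"] times_mds_def[of F "H * K"] mds_coeff_Mds)
  qed
  show "(0::'a mds) \<noteq> 1"
  proof
    assume "(0::'a mds) = 1"
    then have "mds_coeff (0::'a mds) (\<lambda>_. 1) = mds_coeff 1 (\<lambda>_. 1)" by simp
    then show False by (simp add: zero_mds_def one_mds_def mds_coeff_Mds)
  qed
qed

end

text \<open>
  Formal infinite products: every coefficient of the finite partial products is eventually
  constant.
\<close>

definition has_formal_prod :: "(nat \<Rightarrow> 'r::finite mds) \<Rightarrow> nat set \<Rightarrow> 'r mds \<Rightarrow> bool" where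
  "has_formal_prod F A P \<longleftrightarrow>
     (\<forall>n. \<forall>\<^sub>F S in finite_subsets_at_top A. mds_coeff (\<Prod>p\<in>S. F p) n = mds_coeff P n)"

definition formally_multipliable :: "(nat \<Rightarrow> 'r::finite mds) \<Rightarrow> nat set \<Rightarrow> bool" where
  "formally_multipliable F A \<longleftrightarrow> (\<exists>P. has_formal_prod F A P)"

definition formal_prod :: "(nat \<Rightarrow> 'r::finite mds) \<Rightarrow> nat set \<Rightarrow> 'r mds" where
  "formal_prod F A = (THE P. has_formal_prod F A P)"

lemma has_formal_prod_unique:
  assumes "has_formal_prod F A P" "has_formal_prod F A Q"
  shows "P = Q"
proof (rule mds_eqI)
  fix n
  have "\<forall>\<^sub>F S in finite_subsets_at_top A. mds_coeff P n = mds_coeff Q n"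
    using assms[unfolded has_formal_prod_def, rule_format, of n] by eventually_elim simp
  then show "mds_coeff P n = mds_coeff Q n" by simp
qed

lemma formal_prod_eqI: "has_formal_prod F A P \<Longrightarrow> formal_prod F A = P"
  unfolding formal_prod_def by (blast intro: has_formal_prod_unique)

lemma has_formal_prod_formal_prod:
  "formally_multipliable F A \<Longrightarrow> has_formal_prod F A (formal_prod F A)"
  unfolding formally_multipliable_def using formal_prod_eqI by blast


section \<open>The formal counterparts of the series and the product\<close>

text \<open>The term \<open>c / \<Prod>i. m i powr s i\<close>.\<close>

definition mds_monom :: "('r::finite \<Rightarrow> nat) \<Rightarrow> complex \<Rightarrow> 'r mds" where
  "mds_monom m c = Mds (\<lambda>n. if n = m then c else 0)"

definition formal_coprime_series :: "('r::finite \<Rightarrow> nat \<Rightarrow> complex) \<Rightarrow> 'r mds" where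
  "formal_coprime_series f = Mds (\<lambda>n. if n \<in> coprime_tuples then \<Prod>i\<in>UNIV. f i (n i) else 0)"

text \<open>The Dirichlet series of \<open>f\<close> in the single variable \<open>s i\<close>.\<close>

definition formal_D :: "(nat \<Rightarrow> complex) \<Rightarrow> 'r::finite \<Rightarrow> 'r mds" where
  "formal_D f i = Mds (\<lambda>n. if \<forall>k. k \<noteq> i \<longrightarrow> n k = 1 then f (n i) else 0)"

definition formal_Delta_factor ::
    "('r::finite \<Rightarrow> nat \<Rightarrow> nat \<Rightarrow> complex) \<Rightarrow> nat \<Rightarrow> nat \<Rightarrow> 'r mds" where
  "formal_Delta_factor g t p =
     1 + (-1) ^ (CARD('r) - 1) *
       (\<Sum>a | \<forall>i. a i \<in> {1..t}.
          mds_monom (\<lambda>i. p ^ a i) (\<Prod>i\<in>UNIV. (-1) ^ a i * G (g i) t (a i) p))"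

definition formal_Delta :: "('r::finite \<Rightarrow> nat \<Rightarrow> nat \<Rightarrow> complex) \<Rightarrow> nat \<Rightarrow> 'r mds" where
  "formal_Delta g t = formal_prod (formal_Delta_factor g t) {p. prime p}"

end

(*
  Restricting a formal series to tuples of P-smooth numbers is a ring homomorphism, and for a series with
  multiplicative coefficients and finite P the restriction is the product of the restrictions to the single
  primes of P. Let C be the coprime series, let F_i be the restriction of the series of f_i to the powers of
  p, and 1 + H_i = prod_l (1 - g_il(p) p^(-s_i)) its inverse. A tuple of powers of p is coprime unless all of
  its entries exceed 1, so the restriction of C to p is
    prod F_i - prod (F_i - 1) = prod F_i * (1 + (-1)^(r-1) prod H_i),
  and the last factor is the Euler factor of Delta. Each coefficient only involves finitely many primes, which
  gives the formal identity. For the analytic one, the value of an absolutely convergent series is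
  multiplicative in the series; apply it to the identity restricted to the primes up to N and let N tend to
  infinity. The products of the restricted identity are finite, so no convergence of local Euler factors of
  the individual g_ij is needed.
*)

theory Submission
  imports Defs
begin

section \<open>Coefficients of formal Dirichlet series\<close>

text \<open>Gives the linear coefficient rules below at all tuples: at those with a zero entry both
  sides take the default value \<open>0\<close>.\<close>

lemma mds_coeff_pos_or_0: "(\<forall>i. n i \<ge> 1) \<or> (\<forall>F :: 'r::finite mds. mds_coeff F n = 0)"
  by (metis mds_coeff_nonpos less_one not_le)

lemma mds_coeff_zero [simp]: "mds_coeff 0 n = 0"
  by (simp add: zero_mds_def mds_coeff_Mds)

lemma mds_coeff_one: "mds_coeff 1 n = (if \<forall>i. n i = 1 then 1 else 0)"
  by (auto simp: one_mds_def mds_coeff_Mds)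

lemma mds_coeff_add [simp]: "mds_coeff (F + H) n = mds_coeff F n + mds_coeff H n"
  using mds_coeff_pos_or_0[of n] by (auto simp: mds_coeff_nonpos plus_mds_def mds_coeff_Mds)

lemma mds_coeff_uminus [simp]: "mds_coeff (- F) n = - mds_coeff F n"
  using mds_coeff_pos_or_0[of n] by (auto simp: mds_coeff_nonpos uminus_mds_def mds_coeff_Mds)

lemma mds_coeff_minus [simp]: "mds_coeff (F - H) n = mds_coeff F n - mds_coeff H n"
  using mds_coeff_pos_or_0[of n] by (auto simp: mds_coeff_nonpos minus_mds_def mds_coeff_Mds)

lemma mds_coeff_times:
  assumes "\<And>i. n i \<ge> 1"
  shows "mds_coeff (F * H) n = (\<Sum>(d, e)\<in>mult_pairs n. mds_coeff F d * mds_coeff H e)"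
  using assms by (simp add: times_mds_def mds_coeff_Mds)

lemma mds_coeff_sum: "mds_coeff (\<Sum>x\<in>A. F x) n = (\<Sum>x\<in>A. mds_coeff (F x) n)"
  by (induction A rule: infinite_finite_induct) auto

text \<open>Serves products in which at most one factorization of \<open>n\<close> survives:
  monomials, series in disjoint sets of variables, and restrictions to disjoint sets of
  primes.\<close>

lemma mds_coeff_times_unique:
  assumes "\<And>i. n i \<ge> 1" "(\<lambda>i. d i * e i) = n"
    and "\<And>d' e'. (\<lambda>i. d' i * e' i) = n \<Longrightarrow> mds_coeff F d' \<noteq> 0 \<Longrightarrow> mds_coeff H e' \<noteq> 0 \<Longrightarrow> d' = d \<and> e' = e"
  shows "mds_coeff (F * H) n = mds_coeff F d * mds_coeff H e"
proof -
  have "mds_coeff (F * H) n = (\<Sum>(d, e)\<in>mult_pairs n. mds_coeff F d * mds_coeff H e)"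
    by (rule mds_coeff_times) fact
  also have "\<dots> = (\<Sum>(d, e)\<in>{(d, e)}. mds_coeff F d * mds_coeff H e)"
  proof (rule sum.mono_neutral_right)
    show "finite (mult_pairs n)" by (rule finite_mult_pairs) fact
    show "{(d, e)} \<subseteq> mult_pairs n" using assms(2) by blast
    show "\<forall>x\<in>mult_pairs n - {(d, e)}. (case x of (d, e) \<Rightarrow> mds_coeff F d * mds_coeff H e) = 0"
      using assms(3) by fastforce
  qed
  finally show ?thesis by simp
qed

lemma mds_coeff_times_eq_0:
  assumes "\<And>i. n i \<ge> 1"
    and "\<And>d e. (\<lambda>i. d i * e i) = n \<Longrightarrow> mds_coeff F d = 0 \<or> mds_coeff H e = 0"
  shows "mds_coeff (F * H) n = 0"
  unfolding mds_coeff_times[OF assms(1)] by (rule sum.neutral) (use assms(2) in fastforce)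

lemma mds_coeff_monom: "mds_coeff (mds_monom m c) n = (if n = m \<and> (\<forall>i. m i \<ge> 1) then c else 0)"
  by (auto simp: mds_monom_def mds_coeff_Mds)

lemma mds_monom_one: "mds_monom (\<lambda>_. 1) 1 = 1"
  by (rule mds_eqI) (auto simp: mds_coeff_monom mds_coeff_one)

lemma mds_monom_times:
  assumes "\<And>i. m i \<ge> 1" "\<And>i. m' i \<ge> 1"
  shows "mds_monom m a * mds_monom m' b = mds_monom (\<lambda>i. m i * m' i) (a * b)"
proof (rule mds_eqI)
  fix n :: "'a \<Rightarrow> nat" assume n: "\<And>i. n i \<ge> 1"
  show "mds_coeff (mds_monom m a * mds_monom m' b) n = mds_coeff (mds_monom (\<lambda>i. m i * m' i) (a * b)) n"
  proof (cases "n = (\<lambda>i. m i * m' i)")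
    case True
    have "mds_coeff (mds_monom m a * mds_monom m' b) n = mds_coeff (mds_monom m a) m * mds_coeff (mds_monom m' b) m'"
      by (rule mds_coeff_times_unique[OF n True[symmetric]])
         (simp_all add: mds_coeff_monom split: if_splits)
    also have "\<dots> = a * b"
      using assms by (simp add: mds_coeff_monom)
    also have "\<dots> = mds_coeff (mds_monom (\<lambda>i. m i * m' i) (a * b)) n"
      using n unfolding True by (simp add: mds_coeff_monom)
    finally show ?thesis .
  next
    case False
    have "mds_coeff (mds_monom m a * mds_monom m' b) n = 0"
      by (rule mds_coeff_times_eq_0[OF n]) (use False in \<open>auto simp: mds_coeff_monom\<close>)
    with False show ?thesis by (simp add: mds_coeff_monom)
  qed
qed

lemma mds_monom_sum: "mds_monom m (\<Sum>x\<in>A. c x) = (\<Sum>x\<in>A. mds_monom m (c x))"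
proof (rule mds_eqI)
  fix n
  have "(if b then \<Sum>x\<in>A. c x else 0) = (\<Sum>x\<in>A. if b then c x else 0)" for b
    by simp
  then show "mds_coeff (mds_monom m (\<Sum>x\<in>A. c x)) n = mds_coeff (\<Sum>x\<in>A. mds_monom m (c x)) n"
    unfolding mds_coeff_sum mds_coeff_monom .
qed

lemma mds_monom_prod:
  assumes "\<And>x i. x \<in> A \<Longrightarrow> m x i \<ge> 1"
  shows "(\<Prod>x\<in>A. mds_monom (m x) (c x)) = mds_monom (\<lambda>i. \<Prod>x\<in>A. m x i) (\<Prod>x\<in>A. c x)"
  using assms
proof (induction A rule: infinite_finite_induct)
  case (insert x A)
  have "1 \<le> (\<Prod>x\<in>A. m x i)" for i
    by (rule prod_ge_1) (use insert in auto)
  with insert show ?case by (simp add: mds_monom_times)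
qed (auto simp: mds_monom_one[unfolded One_nat_def])

section \<open>One-variable series inside the ring of several variables\<close>

lemma mds_coeff_formal_D:
  "mds_coeff (formal_D f i) n =
     (if (\<forall>k. k \<noteq> i \<longrightarrow> n k = 1) \<and> n i \<ge> 1 then f (n i) else 0)"
  unfolding formal_D_def mds_coeff_Mds by auto

lemma formal_D_cong: "(\<And>n. n \<ge> 1 \<Longrightarrow> f n = h n) \<Longrightarrow> formal_D f i = formal_D h i"
  by (rule mds_eqI) (auto simp: mds_coeff_formal_D)

lemma formal_D_unit: "formal_D (\<lambda>n. if n = 1 then 1 else 0) i = 1"
proof (rule mds_eqI)
  fix n
  show "mds_coeff (formal_D (\<lambda>n. if n = 1 then 1 else 0) i) n = mds_coeff 1 n"
    by (cases "n i = 1") (auto simp: mds_coeff_formal_D mds_coeff_one)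
qed

text \<open>Only factorizations whose two factors are \<open>1\<close> off coordinate
  \<open>i\<close> contribute, and these correspond to the divisors of \<open>n i\<close>.\<close>

lemma formal_D_dirichlet_conv:
  "formal_D (dirichlet_conv f h) i = formal_D f i * formal_D h i"
proof (rule mds_eqI)
  fix n :: "'a \<Rightarrow> nat" assume n: "\<And>i. n i \<ge> 1"
  show "mds_coeff (formal_D (dirichlet_conv f h) i) n = mds_coeff (formal_D f i * formal_D h i) n"
  proof (cases "\<forall>k. k \<noteq> i \<longrightarrow> n k = 1")
    case True
    \<comment> \<open>\<open>e d\<close> has \<open>d\<close> at coordinate \<open>i\<close> and
      \<open>1\<close> elsewhere, so \<open>B\<close> collects all factorizations that can
      contribute.\<close>
    define e where "e = (\<lambda>d k. if k = i then d else (1::nat))"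
    define B where "B = (\<lambda>d. (e d, e (n i div d))) ` {d. d dvd n i}"
    have e: "e d k \<ge> 1 \<longleftrightarrow> k \<noteq> i \<or> d \<ge> 1" for d k by (auto simp: e_def)
    have inj: "inj_on (\<lambda>d. (e d, e (n i div d))) {d. d dvd n i}"
      by (rule inj_onI) (auto simp: e_def dest: fun_cong[of _ _ i])
    have sub: "B \<subseteq> mult_pairs n"
      using True by (auto simp: B_def e_def)
    have "mds_coeff (formal_D f i * formal_D h i) n =
            (\<Sum>(d, e)\<in>mult_pairs n. mds_coeff (formal_D f i) d * mds_coeff (formal_D h i) e)"
      by (rule mds_coeff_times) (rule n)
    also have "\<dots> = (\<Sum>(d, e)\<in>B. mds_coeff (formal_D f i) d * mds_coeff (formal_D h i) e)"
    proof (rule sum.mono_neutral_right[OF finite_mult_pairs[OF n] sub], safe)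
      fix d d' assume d: "n = (\<lambda>i. d i * d' i)" "(d, d') \<notin> B"
      show "mds_coeff (formal_D f i) d * mds_coeff (formal_D h i) d' = 0"
      proof (rule ccontr)
        assume "\<not> ?thesis"
        then have *: "\<forall>k. k \<noteq> i \<longrightarrow> d k = 1" "\<forall>k. k \<noteq> i \<longrightarrow> d' k = 1" "d i \<ge> 1"
          by (auto simp: mds_coeff_formal_D split: if_splits)
        then have "d = e (d i)" "d' = e (n i div d i)" using d by (auto simp: e_def)
        moreover have "d i dvd n i" using d by simp
        ultimately show False using d(2) unfolding B_def by blast
      qed
    qed
    also have "\<dots> = (\<Sum>d | d dvd n i. mds_coeff (formal_D f i) (e d) * mds_coeff (formal_D h i) (e (n i div d)))"
      unfolding B_def by (subst sum.reindex[OF inj]) simp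
    also have "\<dots> = (\<Sum>d | d dvd n i. f d * h (n i div d))"
    proof (rule sum.cong[OF refl])
      fix d assume d: "d \<in> {d. d dvd n i}"
      then obtain c where "n i = d * c" by auto
      with n[of i] have "d \<ge> 1" "n i div d \<ge> 1" by (auto simp: Suc_le_eq)
      then show "mds_coeff (formal_D f i) (e d) * mds_coeff (formal_D h i) (e (n i div d)) = f d * h (n i div d)"
        by (simp add: mds_coeff_formal_D e_def)
    qed
    finally show ?thesis using True n[of i] by (simp add: mds_coeff_formal_D dirichlet_conv_def)
  next
    case False
    then show ?thesis using n
      by (subst mds_coeff_times_eq_0) (auto simp: mds_coeff_formal_D)
  qed
qed

lemma formal_D_dirichlet_conv_upto:
  "formal_D (dirichlet_conv_upto g t) i = (\<Prod>l=1..t. formal_D (g l) i)"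
  by (induction t) (simp_all add: formal_D_unit[unfolded One_nat_def] formal_D_dirichlet_conv)

text \<open>Factors in different variables cannot interfere: splitting off coordinate
  \<open>j\<close> is the only contributing factorization. For \<open>I = UNIV\<close> this is the
  full multiple series with coefficients \<open>h i (n i)\<close> multiplied over
  \<open>i\<close>.\<close>

lemma mds_coeff_prod_formal_D:
  fixes n :: "'r::finite \<Rightarrow> nat"
  assumes "\<And>i. n i \<ge> 1"
  shows "mds_coeff (\<Prod>i\<in>I. formal_D (h i) i) n = (if \<forall>k. k \<notin> I \<longrightarrow> n k = 1 then \<Prod>i\<in>I. h i (n i) else 0)"
  using finite[of I] assms
proof (induction I arbitrary: n rule: finite_induct)
  case empty
  then show ?case by (auto simp: mds_coeff_one)
next
  case (insert j I)
  \<comment> \<open>The support of the partial product, at arbitrary tuples: those with a zero entry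
    have coefficient \<open>0\<close> by default.\<close>
  have IH: "mds_coeff (\<Prod>i\<in>I. formal_D (h i) i) m \<noteq> 0 \<Longrightarrow> \<forall>k. k \<notin> I \<longrightarrow> m k = 1" for m
    using insert.IH[of m] mds_coeff_nonpos[of m] by (cases "\<exists>i. m i = 0") (auto simp: Suc_le_eq split: if_splits)
  define d where "d = (\<lambda>k. if k = j then n k else 1)"
  define e where "e = n(j := 1)"
  have *: "mds_coeff (formal_D (h j) j * (\<Prod>i\<in>I. formal_D (h i) i)) n =
           mds_coeff (formal_D (h j) j) d * mds_coeff (\<Prod>i\<in>I. formal_D (h i) i) e"
  proof (rule mds_coeff_times_unique)
    fix d' e' assume n: "(\<lambda>i. d' i * e' i) = n" and d': "mds_coeff (formal_D (h j) j) d' \<noteq> 0"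
      and e': "mds_coeff (\<Prod>i\<in>I. formal_D (h i) i) e' \<noteq> 0"
    have "d' k = 1" if "k \<noteq> j" for k using d' that by (auto simp: mds_coeff_formal_D split: if_splits)
    moreover have "e' j = 1" using IH[OF e'] insert.hyps by auto
    ultimately show "d' = d \<and> e' = e" using n[symmetric] by (auto simp: d_def e_def)
  qed (use insert.prems in \<open>auto simp: d_def e_def\<close>)
  have "mds_coeff (\<Prod>i\<in>I. formal_D (h i) i) e = (if \<forall>k. k \<notin> I \<longrightarrow> e k = 1 then \<Prod>i\<in>I. h i (e i) else 0)"
    by (rule insert.IH) (use insert.prems in \<open>auto simp: e_def\<close>)
  also have "(\<Prod>i\<in>I. h i (e i)) = (\<Prod>i\<in>I. h i (n i))"
    by (rule prod.cong) (use insert.hyps in \<open>auto simp: e_def\<close>)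
  also have "(\<forall>k. k \<notin> I \<longrightarrow> e k = 1) \<longleftrightarrow> (\<forall>k. k \<notin> insert j I \<longrightarrow> n k = 1)"
    by (auto simp: e_def)
  finally have e: "mds_coeff (\<Prod>i\<in>I. formal_D (h i) i) e = (if \<forall>k. k \<notin> insert j I \<longrightarrow> n k = 1 then \<Prod>i\<in>I. h i (n i) else 0)" .
  have "mds_coeff (formal_D (h j) j) d = h j (n j)"
    using insert.prems by (auto simp: mds_coeff_formal_D d_def)
  moreover have "c * (if b then x else 0) = (if b then c * x else 0)" for b and c x :: complex
    by simp
  ultimately show ?case unfolding prod.insert[OF insert.hyps] * e by (simp only:)
qed

section \<open>Restriction to smooth tuples\<close>

text \<open>For a prime \<open>p\<close>, \<open>smooth {p}\<close> is the set of powers of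
  \<open>p\<close>, described without exponents.\<close>

definition smooth :: "nat set \<Rightarrow> nat set" where
  "smooth P = {n. n \<ge> 1 \<and> (\<forall>q. prime q \<longrightarrow> q dvd n \<longrightarrow> q \<in> P)}"

lemma smooth_pos: "n \<in> smooth P \<Longrightarrow> n \<ge> 1"
  by (simp add: smooth_def)

lemma one_in_smooth [simp]: "1 \<in> smooth P" "Suc 0 \<in> smooth P"
  by (auto simp: smooth_def)

lemma smooth_mono: "P \<subseteq> Q \<Longrightarrow> smooth P \<subseteq> smooth Q"
  by (auto simp: smooth_def)

text \<open>By Euclid's lemma, a prime dividing the product divides a factor. The equivalence is
  what makes \<open>restr\<close> compatible with products.\<close>

lemma smooth_mult_iff: "m * n \<in> smooth P \<longleftrightarrow> m \<in> smooth P \<and> n \<in> smooth P"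
  by (auto simp: smooth_def prime_dvd_mult_iff Suc_le_eq)

lemma smooth_empty: "smooth {} = {1}"
  unfolding smooth_def using prime_factor_nat by fastforce

lemma smooth_coprime:
  assumes "a \<in> smooth P" "b \<in> smooth Q" "P \<inter> Q = {}"
  shows "coprime a b"
proof (rule ccontr)
  assume "\<not> coprime a b"
  then obtain q where "prime q" "q dvd gcd a b"
    using prime_factor_nat[of "gcd a b"] by (auto simp: coprime_iff_gcd_eq_1)
  then show False using assms by (auto simp: smooth_def)
qed

text \<open>Peel off one prime \<open>q\<close> at a time and assign it to \<open>a\<close> or to
  \<open>b\<close> according to a set that contains it.\<close>

lemma smooth_Un_decompose:
  assumes "n \<in> smooth (P \<union> Q)"
  shows "\<exists>a b. a \<in> smooth P \<and> b \<in> smooth Q \<and> a * b = n"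
  using assms
proof (induction n rule: less_induct)
  case (less n)
  show ?case
  proof (cases "n = 1")
    case True
    then show ?thesis by (intro exI[of _ 1]) simp
  next
    case False
    then obtain q m where q: "prime q" "n = q * m" using prime_factor_nat[of n] by auto
    with less.prems have "m \<in> smooth (P \<union> Q)" "q \<in> P \<union> Q"
      by (auto simp: smooth_mult_iff smooth_def)
    moreover have "m < n"
      using q smooth_pos[OF \<open>m \<in> smooth (P \<union> Q)\<close>] prime_gt_1_nat[of q] by simp
    ultimately obtain a b where ab: "a \<in> smooth P" "b \<in> smooth Q" "a * b = m"
      using less.IH by blast
    have q': "q \<in> smooth R" if "q \<in> R" for R
      using that q(1) prime_gt_0_nat[of q] unfolding smooth_def by (auto simp: Suc_le_eq dest: primes_dvd_imp_eq)
    from \<open>q \<in> P \<union> Q\<close> show ?thesis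
    proof
      assume "q \<in> P"
      then have "q * a \<in> smooth P" using q' ab by (simp add: smooth_mult_iff)
      with ab q show ?thesis by (intro exI[of _ "q * a"] exI[of _ b]) simp
    next
      assume "q \<in> Q"
      then have "q * b \<in> smooth Q" using q' ab by (simp add: smooth_mult_iff)
      with ab q show ?thesis by (intro exI[of _ a] exI[of _ "q * b"]) simp
    qed
  qed
qed

text \<open>Disjointness makes \<open>a\<close> coprime to \<open>b'\<close> and \<open>a'\<close>
  coprime to \<open>b\<close>, so \<open>a\<close> and \<open>a'\<close> divide each other.\<close>

lemma smooth_decompose_unique:
  assumes "a \<in> smooth P" "a' \<in> smooth P" "b \<in> smooth Q" "b' \<in> smooth Q" "P \<inter> Q = {}"
    and eq: "a * b = a' * b'"
  shows "a = a' \<and> b = b'"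
proof -
  have "coprime a b'" "coprime a' b" using assms smooth_coprime by blast+
  moreover have "a dvd a' * b'" "a' dvd a * b" using eq by (metis dvd_triv_left)+
  ultimately have "a dvd a'" "a' dvd a" by (simp_all add: coprime_dvd_mult_left_iff)
  then have "a = a'" by (rule dvd_antisym)
  moreover have "a \<ge> 1" by (rule smooth_pos) fact
  ultimately show ?thesis using eq by simp
qed

definition restr :: "nat set \<Rightarrow> 'r::finite mds \<Rightarrow> 'r mds" where
  "restr P F = Mds (\<lambda>n. if \<forall>i. n i \<in> smooth P then mds_coeff F n else 0)"

lemma mds_coeff_restr:
  "mds_coeff (restr P F) n = (if \<forall>i. n i \<in> smooth P then mds_coeff F n else 0)"
  unfolding restr_def mds_coeff_Mds using smooth_pos by (metis (mono_tags))

lemma restr_one [simp]: "restr P 1 = 1"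
  by (rule mds_eqI) (auto simp: mds_coeff_restr mds_coeff_one)

text \<open>Every factorization of a smooth tuple consists of smooth tuples, and a tuple that is not
  smooth has no such factorization.\<close>

lemma restr_times: "restr P (F * H) = restr P F * restr P H"
proof (rule mds_eqI)
  fix n :: "'a \<Rightarrow> nat" assume n: "\<And>i. n i \<ge> 1"
  show "mds_coeff (restr P (F * H)) n = mds_coeff (restr P F * restr P H) n"
  proof (cases "\<forall>i. n i \<in> smooth P")
    case True
    have "(\<Sum>(d, e)\<in>mult_pairs n. mds_coeff (restr P F) d * mds_coeff (restr P H) e) =
          (\<Sum>(d, e)\<in>mult_pairs n. mds_coeff F d * mds_coeff H e)"
    proof (rule sum.cong[OF refl], clarify)
      fix d e :: "'a \<Rightarrow> nat" assume "n = (\<lambda>i. d i * e i)"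
      with True have "\<forall>i. d i \<in> smooth P" "\<forall>i. e i \<in> smooth P"
        by (simp_all add: smooth_mult_iff)
      then show "mds_coeff (restr P F) d * mds_coeff (restr P H) e = mds_coeff F d * mds_coeff H e"
        by (simp add: mds_coeff_restr)
    qed
    then show ?thesis using True by (simp add: mds_coeff_restr mds_coeff_times[OF n])
  next
    case False
    have "mds_coeff (restr P F * restr P H) n = 0"
    proof (rule mds_coeff_times_eq_0[OF n])
      fix d e assume "(\<lambda>i. d i * e i) = n"
      with False have "\<not> ((\<forall>i. d i \<in> smooth P) \<and> (\<forall>i. e i \<in> smooth P))"
        by (auto simp: smooth_mult_iff)
      then show "mds_coeff (restr P F) d = 0 \<or> mds_coeff (restr P H) e = 0"
        by (auto simp: mds_coeff_restr)
    qed
    with False show ?thesis by (auto simp: mds_coeff_restr)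
  qed
qed

lemma restr_prod: "restr P (\<Prod>x\<in>A. F x) = (\<Prod>x\<in>A. restr P (F x))"
  by (induction A rule: infinite_finite_induct) (simp_all add: restr_times)

lemma restr_formal_D:
  "restr P (formal_D f i) = formal_D (\<lambda>n. if n \<in> smooth P then f n else 0) i"
proof (rule mds_eqI)
  fix n
  show "mds_coeff (restr P (formal_D f i)) n = mds_coeff (formal_D (\<lambda>n. if n \<in> smooth P then f n else 0) i) n"
  proof (cases "(\<forall>k. k \<noteq> i \<longrightarrow> n k = 1) \<and> n i \<in> smooth P")
    case True
    then have "\<forall>k. n k \<in> smooth P" by (metis one_in_smooth(1))
    with True show ?thesis by (simp add: mds_coeff_restr mds_coeff_formal_D)
  qed (auto simp: mds_coeff_restr mds_coeff_formal_D)
qed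

text \<open>Multiplicativity for functions of several variables. Coprimality is demanded across all
  pairs of coordinates: no prime divides entries of both tuples.\<close>

definition mds_multiplicative :: "'r::finite mds \<Rightarrow> bool" where
  "mds_multiplicative F \<longleftrightarrow> mds_coeff F (\<lambda>_. 1) = 1 \<and>
     (\<forall>m n. (\<forall>i. m i \<ge> 1) \<longrightarrow> (\<forall>i. n i \<ge> 1) \<longrightarrow> (\<forall>i j. coprime (m i) (n j)) \<longrightarrow>
        mds_coeff F (\<lambda>i. m i * n i) = mds_coeff F m * mds_coeff F n)"

text \<open>A tuple smooth for \<open>P \<union> Q\<close> splits uniquely into a
  \<open>P\<close>-smooth and a \<open>Q\<close>-smooth tuple. No prime is shared by the two, so
  multiplicativity factors the coefficient accordingly.\<close>

lemma restr_Un: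
  assumes F: "mds_multiplicative F" and PQ: "P \<inter> Q = {}"
  shows "restr (P \<union> Q) F = restr P F * restr Q F"
proof (rule mds_eqI)
  fix n :: "'a \<Rightarrow> nat" assume n: "\<And>i. n i \<ge> 1"
  show "mds_coeff (restr (P \<union> Q) F) n = mds_coeff (restr P F * restr Q F) n"
  proof (cases "\<forall>i. n i \<in> smooth (P \<union> Q)")
    case True
    then have "\<forall>i. \<exists>a b. a \<in> smooth P \<and> b \<in> smooth Q \<and> a * b = n i"
      using smooth_Un_decompose by blast
    then obtain a b where ab: "\<And>i. a i \<in> smooth P" "\<And>i. b i \<in> smooth Q" "\<And>i. a i * b i = n i"
      by metis
    have "mds_coeff (restr P F * restr Q F) n = mds_coeff (restr P F) a * mds_coeff (restr Q F) b"
    proof (rule mds_coeff_times_unique[OF n])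
      show "(\<lambda>i. a i * b i) = n" using ab(3) by (rule ext)
      fix a' b' assume *: "(\<lambda>i. a' i * b' i) = n" "mds_coeff (restr P F) a' \<noteq> 0" "mds_coeff (restr Q F) b' \<noteq> 0"
      then have **: "\<forall>i. a' i \<in> smooth P" "\<forall>i. b' i \<in> smooth Q" by (auto simp: mds_coeff_restr split: if_splits)
      have "a' i = a i \<and> b' i = b i" for i
        using smooth_decompose_unique[of "a' i" P "a i" "b' i" Q "b i"] ** ab PQ fun_cong[OF *(1), of i] by auto
      then show "a' = a \<and> b' = b" by auto
    qed
    also have "\<dots> = mds_coeff F a * mds_coeff F b"
      using ab by (simp add: mds_coeff_restr)
    also have "\<dots> = mds_coeff F (\<lambda>i. a i * b i)"
      using F ab smooth_pos smooth_coprime PQ unfolding mds_multiplicative_def by metis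
    also have "(\<lambda>i. a i * b i) = n" using ab(3) by (rule ext)
    finally show ?thesis using True by (simp add: mds_coeff_restr)
  next
    case False
    have "mds_coeff (restr P F * restr Q F) n = 0"
    proof (rule mds_coeff_times_eq_0[OF n])
      fix d e assume "(\<lambda>i. d i * e i) = n"
      with False obtain i where "\<not> (d i \<in> smooth (P \<union> Q) \<and> e i \<in> smooth (P \<union> Q))"
        by (auto simp: smooth_mult_iff)
      then have "\<not> (\<forall>i. d i \<in> smooth P) \<or> \<not> (\<forall>i. e i \<in> smooth Q)"
        using smooth_mono[of P "P \<union> Q"] smooth_mono[of Q "P \<union> Q"] by blast
      then show "mds_coeff (restr P F) d = 0 \<or> mds_coeff (restr Q F) e = 0"
        by (auto simp: mds_coeff_restr)
    qed
    with False show ?thesis by (auto simp: mds_coeff_restr)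
  qed
qed

lemma restr_empty:
  assumes "mds_multiplicative F"
  shows "restr {} F = 1"
proof (rule mds_eqI)
  fix n :: "'a \<Rightarrow> nat"
  show "mds_coeff (restr {} F) n = mds_coeff 1 n"
  proof (cases "\<forall>i. n i = 1")
    case True
    then have n: "n = (\<lambda>_. 1)" by auto
    show ?thesis using assms unfolding n by (simp add: mds_coeff_restr mds_coeff_one mds_multiplicative_def)
  qed (auto simp: mds_coeff_restr mds_coeff_one smooth_empty)
qed

text \<open>The Euler product of a multiplicative series truncated to \<open>P\<close>, obtained by
  splitting off one element of \<open>P\<close> at a time.\<close>

lemma restr_eq_prod:
  assumes "mds_multiplicative F" "finite P"
  shows "restr P F = (\<Prod>p\<in>P. restr {p} F)"
  using assms(2)
proof (induction P rule: finite_induct)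
  case empty
  then show ?case using assms(1) by (simp add: restr_empty)
next
  case (insert p P)
  then show ?case using restr_Un[OF assms(1), of "{p}" P] by simp
qed

section \<open>Multiplicativity of Dirichlet convolutions\<close>

lemma completely_multiplicative_one:
  assumes "completely_multiplicative f"
  shows "f 1 = 1"
proof -
  obtain n where "n \<ge> 1" "f n \<noteq> 0" using assms by (auto simp: completely_multiplicative_def)
  moreover have "f (1 * n) = f 1 * f n"
    using assms \<open>n \<ge> 1\<close> unfolding completely_multiplicative_def by blast
  ultimately show ?thesis by simp
qed

text \<open>For coprime \<open>m\<close> and \<open>n\<close> the divisors of \<open>m * n\<close>
  are the products \<open>a * b\<close> with \<open>a dvd m\<close> and \<open>b dvd n\<close>,
  recovered from \<open>d\<close> as \<open>gcd d m\<close> and \<open>gcd d n\<close>.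
  Complementary divisors factor in the same way.\<close>

lemma dirichlet_conv_coprime:
  assumes f: "\<And>m n. m \<ge> 1 \<Longrightarrow> n \<ge> 1 \<Longrightarrow> coprime m n \<Longrightarrow> f (m * n) = f m * f n"
    and h: "\<And>m n. m \<ge> 1 \<Longrightarrow> n \<ge> 1 \<Longrightarrow> coprime m n \<Longrightarrow> h (m * n) = h m * h n"
    and mn: "m \<ge> 1" "n \<ge> 1" "coprime m n"
  shows "dirichlet_conv f h (m * n) = dirichlet_conv f h m * dirichlet_conv f h n"
proof -
  have gcd: "gcd (a * b) m = a" "gcd (a * b) n = b" if "a dvd m" "b dvd n" for a b
  proof -
    have "coprime n a" "coprime m b"
      using that mn(3) coprime_divisors[of a m n n] coprime_divisors[of m m b n]
      by (simp_all add: coprime_commute)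
    then show "gcd (a * b) m = a" "gcd (a * b) n = b"
      using that by (simp_all add: gcd_mult_left_right_cancel gcd_mult_left_left_cancel gcd_proj1_if_dvd_nat)
  qed
  have decomp: "\<exists>a b. d = a * b \<and> a dvd m \<and> b dvd n" if "d dvd m * n" for d
    using division_decomp[OF that] by blast
  have "dirichlet_conv f h m * dirichlet_conv f h n =
        (\<Sum>x\<in>{a. a dvd m} \<times> {b. b dvd n}. (f (fst x) * h (m div fst x)) * (f (snd x) * h (n div snd x)))"
    by (simp add: dirichlet_conv_def sum_product sum.cartesian_product case_prod_beta)
  also have "\<dots> = (\<Sum>d | d dvd m * n. f d * h (m * n div d))"
  proof (rule sum.reindex_bij_witness[of _ "\<lambda>d. (gcd d m, gcd d n)" "\<lambda>(a, b). a * b"])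
    fix x assume "x \<in> {a. a dvd m} \<times> {b. b dvd n}"
    then obtain a b where x: "x = (a, b)" and ab: "a dvd m" "b dvd n" by auto
    show "(\<lambda>d. (gcd d m, gcd d n)) (case x of (a, b) \<Rightarrow> a * b) = x"
      using gcd[OF ab] by (simp add: x)
    show "(case x of (a, b) \<Rightarrow> a * b) \<in> {d. d dvd m * n}"
      using ab by (simp add: x mult_dvd_mono)
    obtain a' b' where a': "m = a * a'" "n = b * b'" using ab by (elim dvdE)
    with mn have pos: "a \<ge> 1" "a' \<ge> 1" "b \<ge> 1" "b' \<ge> 1" by (auto simp: Suc_le_eq)
    have cop: "coprime a b" "coprime a' b'" using mn(3) a' by auto
    have "m * n div (a * b) = a' * b'" using a' pos by (simp add: mult_ac)
    then show "f (case x of (a, b) \<Rightarrow> a * b) * h (m * n div (case x of (a, b) \<Rightarrow> a * b)) =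
               (f (fst x) * h (m div fst x)) * (f (snd x) * h (n div snd x))"
      using f[of a b] h[of a' b'] pos cop a' by (simp add: x)
  next
    fix d assume "d \<in> {d. d dvd m * n}"
    then obtain a b where "d = a * b" "a dvd m" "b dvd n" using decomp[of d] by auto
    then show "(case (gcd d m, gcd d n) of (a, b) \<Rightarrow> a * b) = d" using gcd by simp
  qed auto
  finally show ?thesis by (simp add: dirichlet_conv_def)
qed

lemma dirichlet_conv_upto_coprime:
  assumes "\<And>l. l \<in> {1..t} \<Longrightarrow> completely_multiplicative (g l)"
    and "m \<ge> 1" "n \<ge> 1" "coprime m n"
  shows "dirichlet_conv_upto g t (m * n) = dirichlet_conv_upto g t m * dirichlet_conv_upto g t n"
  using assms
proof (induction t arbitrary: m n)
  case (Suc t)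
  have g: "completely_multiplicative (g (Suc t))" by (rule Suc.prems) simp
  show ?case unfolding dirichlet_conv_upto.simps
  proof (rule dirichlet_conv_coprime)
    show "dirichlet_conv_upto g t (m * n) = dirichlet_conv_upto g t m * dirichlet_conv_upto g t n"
      if "m \<ge> 1" "n \<ge> 1" "coprime m n" for m n
      by (rule Suc.IH) (use Suc.prems(1) that in auto)
  qed (use g Suc.prems in \<open>auto simp: completely_multiplicative_def\<close>)
qed simp

lemma dirichlet_conv_upto_one:
  assumes "\<And>l. l \<in> {1..t} \<Longrightarrow> completely_multiplicative (g l)"
  shows "dirichlet_conv_upto g t 1 = 1"
  using assms
proof (induction t)
  case (Suc t)
  have "g (Suc t) 1 = 1" by (rule completely_multiplicative_one) (use Suc.prems in simp)
  with Suc show ?case by (simp add: dirichlet_conv_def)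
qed simp

section \<open>Local factors\<close>

text \<open>The geometric series in coefficients: the series of \<open>g\<close> over the powers of
  \<open>p\<close> is inverse to 1 - g(p) p^(-s). At a power \<open>n = p * m\<close> the two
  surviving terms \<open>g n\<close> and \<open>- g p * g m\<close> cancel.\<close>

lemma dirichlet_conv_local_inverse:
  assumes p: "prime p" and g: "completely_multiplicative g" and n: "n \<ge> 1"
  shows "dirichlet_conv (\<lambda>n. if n \<in> smooth {p} then g n else 0)
           (\<lambda>n. if n = 1 then 1 else if n = p then - g p else 0) n = (if n = 1 then 1 else 0)"
    (is "dirichlet_conv ?g ?h n = _")
proof -
  have "finite {d. d dvd n}" using n by simp
  have p1: "p > 1" using p by (rule prime_gt_1_nat)
  have quot: "n div d = 1 \<longleftrightarrow> d = n" if "d dvd n" for d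
    using that n by auto
  show ?thesis
  proof (cases "p dvd n")
    case True
    then obtain m where m: "n = p * m" by auto
    with n have m1: "m \<ge> 1" by (simp add: Suc_le_eq)
    \<comment> \<open>\<open>?h\<close> is nonzero at most at the quotients \<open>1\<close> and
      \<open>p\<close>, which belong to the divisors \<open>n\<close> and \<open>m\<close>.\<close>
    have "dirichlet_conv ?g ?h n = (\<Sum>d\<in>{n, m}. ?g d * ?h (n div d))"
      unfolding dirichlet_conv_def
    proof (rule sum.mono_neutral_right)
      show "\<forall>d\<in>{d. d dvd n} - {n, m}. ?g d * ?h (n div d) = 0"
      proof
        fix d assume d: "d \<in> {d. d dvd n} - {n, m}"
        then obtain c where c: "n = d * c" by auto
        with d n m p1 have "n div d = c" "c \<noteq> 1" "c \<noteq> p" by auto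
        then show "?g d * ?h (n div d) = 0" by simp
      qed
    qed (use n m in auto)
    also have "\<dots> = ?g n * ?h 1 + ?g m * ?h p"
      using m m1 p1 by simp
    also have "\<dots> = 0"
    \<comment> \<open>\<open>m\<close> and \<open>n = p * m\<close> are either both powers of
      \<open>p\<close>, and the terms cancel, or neither is, and both terms vanish.\<close>
    proof (cases "m \<in> smooth {p}")
      case True
      have "p \<in> smooth {p}"
        using p p1 by (auto simp: smooth_def dest: primes_dvd_imp_eq)
      with True have "n \<in> smooth {p}" by (simp add: m smooth_mult_iff)
      moreover have "g n = g p * g m"
        using g m1 p1 by (simp add: m completely_multiplicative_def)
      ultimately show ?thesis using True p1 by simp
    next
      case False
      then show ?thesis using m by (simp add: smooth_mult_iff)
    qed
    finally show ?thesis using m p1 by simp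
  next
    case False
    have "dirichlet_conv ?g ?h n = (\<Sum>d\<in>{n}. ?g d * ?h (n div d))"
      unfolding dirichlet_conv_def
    proof (rule sum.mono_neutral_right)
      show "\<forall>d\<in>{d. d dvd n} - {n}. ?g d * ?h (n div d) = 0"
      proof
        fix d assume d: "d \<in> {d. d dvd n} - {n}"
        then obtain c where c: "n = d * c" by auto
        with d n False have "n div d = c" "c \<noteq> 1" "c \<noteq> p" by auto
        then show "?g d * ?h (n div d) = 0" by simp
      qed
    qed (use n in auto)
    also have "\<dots> = ?g n" using n by simp
    \<comment> \<open>The only power of \<open>p\<close> not divisible by \<open>p\<close> is
      \<open>1\<close>.\<close>
    also have "\<dots> = (if n = 1 then 1 else 0)"
      using False prime_factor_nat[of n] completely_multiplicative_one[OF g] by (auto simp: smooth_def)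
    finally show ?thesis .
  qed
qed

text \<open>The second factor is 1 - g(p) p^(-s_i), so this is the convolution inverse just found,
  carried over to the variable \<open>s i\<close>.\<close>

lemma restr_formal_D_inverse:
  assumes p: "prime p" and g: "completely_multiplicative g"
  shows "restr {p} (formal_D g i) * (mds_monom (\<lambda>k. if k = i then p else 1) (- g p) + 1) = 1"
proof -
  have p1: "p > 1" using p by (rule prime_gt_1_nat)
  have "mds_monom (\<lambda>k. if k = i then p else 1) (- g p) + 1 =
        formal_D (\<lambda>n. if n = 1 then 1 else if n = p then - g p else 0) i" (is "?l = ?r")
  proof (rule mds_eqI)
    fix n
    have "n = (\<lambda>k. if k = i then p else 1) \<longleftrightarrow> n i = p \<and> (\<forall>k. k \<noteq> i \<longrightarrow> n k = 1)"
      by (auto simp: fun_eq_iff)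
    moreover have "(\<forall>k. n k = 1) \<longleftrightarrow> n i = 1 \<and> (\<forall>k. k \<noteq> i \<longrightarrow> n k = 1)"
      by metis
    ultimately show "mds_coeff ?l n = mds_coeff ?r n"
      unfolding mds_coeff_add mds_coeff_monom mds_coeff_one mds_coeff_formal_D
      using p1 by auto
  qed
  then have "restr {p} (formal_D g i) * ?l = formal_D (\<lambda>n. if n = 1 then 1 else 0) i"
    by (simp only: restr_formal_D formal_D_dirichlet_conv[symmetric])
       (rule formal_D_cong, rule dirichlet_conv_local_inverse[OF p g])
  then show ?thesis by (simp only: formal_D_unit)
qed

text \<open>Vieta's expansion: choosing the monomial for the indices in \<open>L\<close> and
  \<open>1\<close> for the others gives one term for each subset \<open>L\<close>, and the subsets
  of size \<open>j\<close> add up to the elementary symmetric polynomial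
  \<open>G g t j p\<close>.\<close>

lemma prod_local_expand:
  assumes p: "prime p"
  shows "(\<Prod>l\<in>{1..t}. mds_monom (\<lambda>k. if k = i then p else 1) (- g l p) + 1) =
         1 + (\<Sum>j\<in>{1..t}. mds_monom (\<lambda>k. if k = i then p ^ j else 1) ((-1) ^ j * G g t j p))"
proof -
  have p1: "p \<ge> 1" using p prime_ge_1_nat by blast
  define m where "m = (\<lambda>j k. if k = i then p ^ j else 1)"
  have m: "m j k \<ge> 1" for j k using p1 by (simp add: m_def)
  have m0: "m 0 = (\<lambda>_. 1)" by (auto simp: m_def)
  have *: "(\<Prod>l\<in>L. mds_monom (\<lambda>k. if k = i then p else 1) (- g l p)) =
        mds_monom (m (card L)) ((-1) ^ card L * (\<Prod>l\<in>L. g l p))" for L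
  proof -
    have "(\<Prod>l\<in>L. mds_monom (\<lambda>k. if k = i then p else 1) (- g l p)) =
          mds_monom (\<lambda>k. \<Prod>l\<in>L. if k = i then p else 1) (\<Prod>l\<in>L. - g l p)"
      by (rule mds_monom_prod) (use p1 in auto)
    also have "(\<lambda>k. \<Prod>l\<in>L. if k = i then p else 1) = m (card L)"
      by (auto simp: m_def)
    finally show ?thesis by (simp only: prod_uminus)
  qed
  have "(\<Prod>l\<in>{1..t}. mds_monom (\<lambda>k. if k = i then p else 1) (- g l p) + 1) =
        (\<Sum>L\<in>Pow {1..t}. mds_monom (m (card L)) ((-1) ^ card L * (\<Prod>l\<in>L. g l p)))"
    by (subst prod_add) (simp_all only: * finite_atLeastAtMost prod.neutral_const mult_1_right)
  \<comment> \<open>The monomial depends on \<open>L\<close> only through \<open>card L\<close>,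
    hence the grouping by size.\<close>
  also have "\<dots> = (\<Sum>j\<in>{0..t}. \<Sum>L\<in>{L \<in> Pow {1..t}. card L = j}. mds_monom (m (card L)) ((-1) ^ card L * (\<Prod>l\<in>L. g l p)))"
    by (rule sum.group[symmetric]) (auto dest: card_mono[rotated])
  also have "\<dots> = (\<Sum>j\<in>{0..t}. mds_monom (m j) ((-1) ^ j * G g t j p))"
  proof (rule sum.cong[OF refl])
    fix j
    have "(\<Sum>L\<in>{L \<in> Pow {1..t}. card L = j}. mds_monom (m (card L)) ((-1) ^ card L * (\<Prod>l\<in>L. g l p))) =
          (\<Sum>L | L \<subseteq> {1..t} \<and> card L = j. mds_monom (m j) ((-1) ^ j * (\<Prod>l\<in>L. g l p)))"
      by (rule sum.cong) auto
    then show "(\<Sum>L\<in>{L \<in> Pow {1..t}. card L = j}. mds_monom (m (card L)) ((-1) ^ card L * (\<Prod>l\<in>L. g l p))) =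
          mds_monom (m j) ((-1) ^ j * G g t j p)"
      by (simp only: G_def sum_distrib_left mds_monom_sum)
  qed
  \<comment> \<open>The empty subset yields the constant \<open>1\<close>, which is set apart
    because the sums in \<open>Delta_factor\<close> start at exponent \<open>1\<close>.\<close>
  also have "\<dots> = mds_monom (m 0) ((-1) ^ 0 * G g t 0 p) + (\<Sum>j\<in>{1..t}. mds_monom (m j) ((-1) ^ j * G g t j p))"
    by (simp add: sum.atLeast_Suc_atMost)
  also have "G g t 0 p = 1"
  proof -
    have "{L. L \<subseteq> {1..t} \<and> card L = 0} = {{}}"
      by (auto dest: finite_subset[OF _ finite_atLeastAtMost])
    then show ?thesis by (simp add: G_def)
  qed
  finally show ?thesis unfolding m0 by (simp only: mult_1_right power_0 mds_monom_one m_def)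
qed

text \<open>Distributing the product over \<open>i\<close> amounts to choosing an exponent
  \<open>a i\<close> for each variable; monomials in different variables combine into the one at the
  tuple of all \<open>p ^ a i\<close>.\<close>

lemma formal_Delta_factor_eq:
  fixes g :: "'r::finite \<Rightarrow> nat \<Rightarrow> nat \<Rightarrow> complex"
  assumes p: "prime p"
  shows "formal_Delta_factor g t p = 1 + (-1) ^ (CARD('r) - 1) *
           (\<Prod>i\<in>UNIV. \<Sum>j\<in>{1..t}. mds_monom (\<lambda>k. if k = i then p ^ j else 1) ((-1) ^ j * G (g i) t j p))"
proof -
  have p1: "p \<ge> 1" using p prime_ge_1_nat by blast
  have "(\<Prod>i\<in>UNIV. \<Sum>j\<in>{1..t}. mds_monom (\<lambda>k. if k = i then p ^ j else 1) ((-1) ^ j * G (g i) t j p)) =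
        (\<Sum>a\<in>PiE UNIV (\<lambda>_::'r. {1..t}). \<Prod>i\<in>UNIV. mds_monom (\<lambda>k. if k = i then p ^ a i else 1) ((-1) ^ a i * G (g i) t (a i) p))"
    by (rule prod_sum_PiE) auto
  also have "PiE UNIV (\<lambda>_::'r. {1..t}) = {a. \<forall>i. a i \<in> {1..t}}"
    by (auto simp: PiE_def)
  also have "(\<Sum>a | \<forall>i. a i \<in> {1..t}. \<Prod>i\<in>UNIV. mds_monom (\<lambda>k. if k = i then p ^ a i else 1) ((-1) ^ a i * G (g i) t (a i) p)) =
             (\<Sum>a | \<forall>i. a i \<in> {1..t}. mds_monom (\<lambda>i. p ^ a i) (\<Prod>i\<in>UNIV. (-1) ^ a i * G (g i) t (a i) p))"
  proof (rule sum.cong[OF refl])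
    fix a :: "'r \<Rightarrow> nat"
    have "(\<Prod>i\<in>UNIV. mds_monom (\<lambda>k. if k = i then p ^ a i else 1) ((-1) ^ a i * G (g i) t (a i) p)) =
          mds_monom (\<lambda>k. \<Prod>i\<in>UNIV. if k = i then p ^ a i else 1) (\<Prod>i\<in>UNIV. (-1) ^ a i * G (g i) t (a i) p)"
      by (rule mds_monom_prod) (use p1 in auto)
    also have "(\<lambda>k. \<Prod>i\<in>UNIV. if k = i then p ^ a i else 1) = (\<lambda>k. p ^ a k)"
      by (simp add: prod.delta')
    finally show "(\<Prod>i\<in>UNIV. mds_monom (\<lambda>k. if k = i then p ^ a i else 1) ((-1) ^ a i * G (g i) t (a i) p)) =
          mds_monom (\<lambda>i. p ^ a i) (\<Prod>i\<in>UNIV. (-1) ^ a i * G (g i) t (a i) p)" .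
  qed
  finally show ?thesis by (simp only: formal_Delta_factor_def)
qed

section \<open>Coprimality of tuples, prime by prime\<close>

lemma coprime_tuples_iff:
  "n \<in> coprime_tuples \<longleftrightarrow> (\<forall>i. n i \<ge> 1) \<and> (\<forall>q. prime q \<longrightarrow> \<not> (\<forall>i. q dvd n i))"
proof -
  have "Gcd (range n) = 1 \<longleftrightarrow> (\<forall>q. prime q \<longrightarrow> \<not> (\<forall>i. q dvd n i))"
  proof
    assume *: "Gcd (range n) = 1"
    show "\<forall>q. prime q \<longrightarrow> \<not> (\<forall>i. q dvd n i)"
    proof (intro allI impI notI)
      fix q assume "prime q" "\<forall>i. q dvd n i"
      then have "q dvd Gcd (range n)" by (intro Gcd_greatest) auto
      with * \<open>prime q\<close> show False by simp
    qed
  next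
    assume *: "\<forall>q. prime q \<longrightarrow> \<not> (\<forall>i. q dvd n i)"
    show "Gcd (range n) = 1"
    proof (rule ccontr)
      assume "Gcd (range n) \<noteq> 1"
      then obtain q where "prime q" "q dvd Gcd (range n)" using prime_factor_nat by blast
      then have "\<forall>i. q dvd n i" by (meson Gcd_dvd dvd_trans rangeI)
      with * \<open>prime q\<close> show False by blast
    qed
  qed
  then show ?thesis by (simp add: coprime_tuples_def)
qed

text \<open>A prime dividing every \<open>m i * n i\<close> cannot divide entries of both tuples, so
  it divides all entries of one of them.\<close>

lemma coprime_tuples_mult_iff:
  assumes cop: "\<And>i j. coprime (m i) (n j)" and "\<And>i. m i \<ge> 1" "\<And>i. n i \<ge> 1"
  shows "(\<lambda>i. m i * n i) \<in> coprime_tuples \<longleftrightarrow> m \<in> coprime_tuples \<and> n \<in> coprime_tuples"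
proof -
  have "(\<forall>i. q dvd m i * n i) \<longleftrightarrow> (\<forall>i. q dvd m i) \<or> (\<forall>i. q dvd n i)" if q: "prime q" for q
  proof
    assume *: "\<forall>i. q dvd m i * n i"
    show "(\<forall>i. q dvd m i) \<or> (\<forall>i. q dvd n i)"
    proof (rule ccontr)
      assume "\<not> ?thesis"
      then obtain i j where ij: "\<not> q dvd m i" "\<not> q dvd n j" by blast
      with * q have "q dvd n i" "q dvd m j" by (auto simp: prime_dvd_mult_iff)
      with cop[of j i] have "q dvd 1" by (meson coprime_common_divisor)
      with q show False by simp
    qed
  qed auto
  moreover have "\<forall>i. m i * n i \<ge> 1" using assms(2,3) by (simp add: Suc_le_eq)
  ultimately show ?thesis using assms(2,3) unfolding coprime_tuples_iff by blast
qed

section \<open>The multiple series of \<open>f\<close> and their local identity\<close>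

locale convolved_functions =
  fixes g :: "'r::finite \<Rightarrow> nat \<Rightarrow> nat \<Rightarrow> complex" and f :: "'r \<Rightarrow> nat \<Rightarrow> complex" and t :: nat
  assumes g: "\<And>i j. j \<in> {1..t} \<Longrightarrow> completely_multiplicative (g i j)"
    and f: "\<And>i n. n \<ge> 1 \<Longrightarrow> f i n = dirichlet_conv_upto (g i) t n"
begin

lemma f_one: "f i 1 = 1"
  using dirichlet_conv_upto_one[of t "g i"] g f[of 1 i] by simp

lemma f_coprime: "m \<ge> 1 \<Longrightarrow> n \<ge> 1 \<Longrightarrow> coprime m n \<Longrightarrow> f i (m * n) = f i m * f i n"
  using dirichlet_conv_upto_coprime[of t "g i" m n] g f[of m i] f[of n i] f[of "m * n" i]
  by (simp add: Suc_le_eq)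

lemma formal_D_f: "formal_D (f i) i = (\<Prod>l=1..t. formal_D (g i l) i)"
  unfolding formal_D_dirichlet_conv_upto[symmetric] by (rule formal_D_cong) (rule f)

lemma mds_coeff_prod_D:
  assumes "\<And>i. n i \<ge> 1"
  shows "mds_coeff (\<Prod>i\<in>UNIV. formal_D (f i) i) n = (\<Prod>i\<in>UNIV. f i (n i))"
  by (subst mds_coeff_prod_formal_D) (use assms in auto)

lemma prod_f_coprime:
  assumes "\<And>i. m i \<ge> 1" "\<And>i. n i \<ge> 1" "\<And>i j. coprime (m i) (n j)"
  shows "(\<Prod>i\<in>UNIV. f i (m i * n i)) = (\<Prod>i\<in>UNIV. f i (m i)) * (\<Prod>i\<in>UNIV. f i (n i))"
  using assms by (simp add: f_coprime prod.distrib)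

lemma multiplicative_prod_D: "mds_multiplicative (\<Prod>i\<in>UNIV. formal_D (f i) i)"
  unfolding mds_multiplicative_def
proof (intro conjI allI impI)
  show "mds_coeff (\<Prod>i\<in>UNIV. formal_D (f i) i) (\<lambda>_. 1) = 1"
    using f_one by (subst mds_coeff_prod_D) simp_all
next
  fix m n :: "'r \<Rightarrow> nat"
  assume *: "\<forall>i. m i \<ge> 1" "\<forall>i. n i \<ge> 1" "\<forall>i j. coprime (m i) (n j)"
  then have "m i * n i \<ge> 1" for i by (simp add: Suc_le_eq)
  with * show "mds_coeff (\<Prod>i\<in>UNIV. formal_D (f i) i) (\<lambda>i. m i * n i) =
    mds_coeff (\<Prod>i\<in>UNIV. formal_D (f i) i) m * mds_coeff (\<Prod>i\<in>UNIV. formal_D (f i) i) n"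
    by (simp only: mds_coeff_prod_D prod_f_coprime)
qed

lemma mds_coeff_coprime_series:
  "mds_coeff (formal_coprime_series f) n = (if n \<in> coprime_tuples then \<Prod>i\<in>UNIV. f i (n i) else 0)"
  by (simp add: formal_coprime_series_def mds_coeff_Mds coprime_tuples_def)

lemma multiplicative_coprime_series: "mds_multiplicative (formal_coprime_series f)"
  unfolding mds_multiplicative_def
proof (intro conjI allI impI)
  have "(\<lambda>_::'r. 1::nat) \<in> coprime_tuples" by (simp add: coprime_tuples_def)
  then show "mds_coeff (formal_coprime_series f) (\<lambda>_. 1) = 1"
    using f_one by (simp add: mds_coeff_coprime_series)
next
  fix m n :: "'r \<Rightarrow> nat"
  assume *: "\<forall>i. m i \<ge> 1" "\<forall>i. n i \<ge> 1" "\<forall>i j. coprime (m i) (n j)"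
  then have "(\<lambda>i. m i * n i) \<in> coprime_tuples \<longleftrightarrow> m \<in> coprime_tuples \<and> n \<in> coprime_tuples"
    by (intro coprime_tuples_mult_iff) auto
  moreover have "(\<Prod>i\<in>UNIV. f i (m i * n i)) = (\<Prod>i\<in>UNIV. f i (m i)) * (\<Prod>i\<in>UNIV. f i (n i))"
    using * by (intro prod_f_coprime) auto
  ultimately show "mds_coeff (formal_coprime_series f) (\<lambda>i. m i * n i) =
    mds_coeff (formal_coprime_series f) m * mds_coeff (formal_coprime_series f) n"
    by (simp add: mds_coeff_coprime_series)
qed

text \<open>Subtracting \<open>1\<close> removes the term at \<open>n i = 1\<close> from a
  one-variable factor. The second product therefore runs over the tuples of powers of
  \<open>p\<close> with every entry divisible by \<open>p\<close>, which are exactly the tuples to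
  be excluded.\<close>

lemma local_coprime_series:
  assumes p: "prime p"
  shows "restr {p} (formal_coprime_series f) =
    (\<Prod>i\<in>UNIV. restr {p} (formal_D (f i) i)) - (\<Prod>i\<in>UNIV. restr {p} (formal_D (f i) i) - 1)"
proof -
  have dvd: "p dvd n \<longleftrightarrow> n \<noteq> 1" if "n \<in> smooth {p}" for n
    using that p prime_factor_nat[of n] by (auto simp: smooth_def)
  have "restr {p} (formal_D (f i) i) - 1 = formal_D (\<lambda>n. if n \<in> smooth {p} \<and> n \<noteq> 1 then f i n else 0) i" (is "?l = ?r") for i
  proof -
    \<comment> \<open>Since \<open>f i 1 = 1\<close>, the unit series accounts precisely for the
      missing coefficient at \<open>1\<close>.\<close>
    have "?r + formal_D (\<lambda>n. if n = 1 then 1 else 0) i = restr {p} (formal_D (f i) i)"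
      unfolding restr_formal_D
    proof (rule mds_eqI)
      fix n
      show "mds_coeff (?r + formal_D (\<lambda>n. if n = 1 then 1 else 0) i) n =
            mds_coeff (formal_D (\<lambda>n. if n \<in> smooth {p} then f i n else 0) i) n"
        unfolding mds_coeff_add mds_coeff_formal_D by (cases "n i = 1") (auto simp: f_one[unfolded One_nat_def])
    qed
    then show ?thesis unfolding formal_D_unit by (metis add_diff_cancel_right')
  qed
  then have *: "(\<Prod>i\<in>UNIV. restr {p} (formal_D (f i) i) - 1) =
      (\<Prod>i\<in>UNIV. formal_D (\<lambda>n. if n \<in> smooth {p} \<and> n \<noteq> 1 then f i n else 0) i)"
    by simp
  show ?thesis
  proof (rule mds_eqI)
    fix n :: "'r \<Rightarrow> nat" assume n: "\<And>i. n i \<ge> 1"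
    have "mds_coeff (restr {p} (formal_coprime_series f)) n =
      (\<Prod>i\<in>UNIV. if n i \<in> smooth {p} then f i (n i) else 0) -
      (\<Prod>i\<in>UNIV. if n i \<in> smooth {p} \<and> n i \<noteq> 1 then f i (n i) else 0)" (is "_ = ?A - ?B")
    proof (cases "\<forall>i. n i \<in> smooth {p}")
      case True
      have A: "?A = (\<Prod>i\<in>UNIV. f i (n i))" using True by simp
      show ?thesis
      proof (cases "\<forall>i. n i \<noteq> 1")
        case ne: True
        with True dvd p have "n \<notin> coprime_tuples" unfolding coprime_tuples_iff by blast
        moreover have "?B = (\<Prod>i\<in>UNIV. f i (n i))" by (rule prod.cong) (use True ne in auto)
        ultimately show ?thesis unfolding A by (simp add: mds_coeff_restr mds_coeff_coprime_series)
      next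
        case False
        then obtain i where i: "n i = 1" by blast
        then have "n \<in> coprime_tuples"
          unfolding coprime_tuples_iff using n by (metis not_prime_unit)
        moreover have "?B = 0" by (rule prod_zero) (use i in auto)
        ultimately show ?thesis unfolding A using True by (simp add: mds_coeff_restr mds_coeff_coprime_series)
      qed
    next
      case False
      then obtain i where i: "n i \<notin> smooth {p}" by blast
      have "?A = 0" "?B = 0" by (rule prod_zero; use i in auto)+
      moreover have "mds_coeff (restr {p} (formal_coprime_series f)) n = 0"
        using i by (auto simp: mds_coeff_restr)
      ultimately show ?thesis by (simp only: diff_zero)
    qed
    then show "mds_coeff (restr {p} (formal_coprime_series f)) n =
      mds_coeff ((\<Prod>i\<in>UNIV. restr {p} (formal_D (f i) i)) - (\<Prod>i\<in>UNIV. restr {p} (formal_D (f i) i) - 1)) n"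
      unfolding * unfolding restr_formal_D mds_coeff_minus mds_coeff_prod_formal_D[OF n] by simp
  qed
qed

text \<open>From \<open>F i * (1 + H i) = 1\<close> comes \<open>F i - 1 = - (F i * H i)\<close>.
  Multiplying over all \<open>i\<close> produces the sign \<open>(-1) ^ CARD('r)\<close>, and the
  subtraction in the local coprime series lowers its exponent by one.\<close>

lemma local_identity:
  assumes p: "prime p"
  shows "restr {p} (formal_coprime_series f) =
    restr {p} (\<Prod>i\<in>UNIV. formal_D (f i) i) * formal_Delta_factor g t p"
proof -
  define F where "F = (\<lambda>i. restr {p} (formal_D (f i) i))"
  define H where "H = (\<lambda>i::'r. \<Sum>j\<in>{1..t}. mds_monom (\<lambda>k. if k = i then p ^ j else 1) ((-1) ^ j * G (g i) t j p))"
  have inv: "F i * (1 + H i) = 1" for i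
  proof -
    \<comment> \<open>Both factors split over \<open>l\<close>: the local series of
      \<open>f i\<close> into those of the \<open>g i l\<close>, and \<open>1 + H i\<close> into the
      matching inverses.\<close>
    have "F i * (1 + H i) = (\<Prod>l\<in>{1..t}. restr {p} (formal_D (g i l) i) *
        (mds_monom (\<lambda>k. if k = i then p else 1) (- g i l p) + 1))"
      unfolding F_def H_def prod_local_expand[OF p, symmetric] formal_D_f restr_prod prod.distrib ..
    also have "\<dots> = 1"
      by (rule prod.neutral) (use restr_formal_D_inverse[OF p g] in blast)
    finally show ?thesis .
  qed
  have "F i - 1 = - (F i * H i)" for i
  proof -
    have "F i - 1 = F i - (F i + F i * H i)"
      using inv[of i] by (simp only: distrib_left mult_1_right)
    then show ?thesis by simp
  qed
  then have "(\<Prod>i\<in>UNIV. F i - 1) = (-1) ^ CARD('r) * ((\<Prod>i\<in>UNIV. F i) * (\<Prod>i\<in>UNIV. H i))"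
    by (simp add: prod_uminus prod.distrib)
  \<comment> \<open>\<open>CARD('r)\<close> is positive, so the subtraction in the exponent is not
    truncated.\<close>
  also have "(-1 :: 'r mds) ^ CARD('r) = - ((-1) ^ (CARD('r) - 1))"
    by (cases "CARD('r)") simp_all
  finally have "(\<Prod>i\<in>UNIV. F i) - (\<Prod>i\<in>UNIV. F i - 1) =
     (\<Prod>i\<in>UNIV. F i) * (1 + (-1) ^ (CARD('r) - 1) * (\<Prod>i\<in>UNIV. H i))"
    by (simp add: algebra_simps)
  then show ?thesis
    unfolding local_coprime_series[OF p] formal_Delta_factor_eq[OF p] restr_prod F_def H_def .
qed

text \<open>Both multiple series are multiplicative, so their restrictions are products of local
  ones and the local identities multiply up. The formal and the analytic statement both rest on this
  finite identity.\<close>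

lemma smooth_identity:
  assumes "finite P" "\<And>p. p \<in> P \<Longrightarrow> prime p"
  shows "restr P (formal_coprime_series f) =
    restr P (\<Prod>i\<in>UNIV. formal_D (f i) i) * (\<Prod>p\<in>P. formal_Delta_factor g t p)"
  unfolding restr_eq_prod[OF multiplicative_coprime_series assms(1)]
    restr_eq_prod[OF multiplicative_prod_D assms(1)] prod.distrib[symmetric]
  by (rule prod.cong[OF refl]) (use assms(2) local_identity in blast)

end

section \<open>The formal Euler product and the formal identity\<close>

text \<open>All exponents \<open>a i\<close> are at least \<open>1\<close>, so apart from its
  constant the factor lives on tuples with every entry divisible by \<open>p\<close>.\<close>

lemma mds_coeff_Delta_factor_eq_one:
  fixes n :: "'r::finite \<Rightarrow> nat"
  assumes "\<not> p dvd n i" "prime p"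
  shows "mds_coeff (formal_Delta_factor g t p) n = mds_coeff 1 n"
proof -
  define S :: "'r mds" where "S = (\<Sum>a | \<forall>i. a i \<in> {1..t}. mds_monom (\<lambda>i. p ^ a i) (\<Prod>i\<in>UNIV. (-1) ^ a i * G (g i) t (a i) p))"
  have "mds_coeff S n = 0"
    unfolding S_def mds_coeff_sum mds_coeff_monom
  proof (rule sum.neutral, safe)
    fix a :: "'r \<Rightarrow> nat" assume a: "\<forall>i. a i \<in> {1..t}"
    have "n \<noteq> (\<lambda>i. p ^ a i)"
    proof
      assume "n = (\<lambda>i. p ^ a i)"
      then have "n i = p ^ a i" by simp
      moreover have "a i \<ge> 1" using a by simp
      ultimately show False using assms(1) by (simp add: dvd_power)
    qed
    then show "(if n = (\<lambda>i. p ^ a i) \<and> (\<forall>i. 1 \<le> p ^ a i) then \<Prod>i\<in>UNIV. (-1) ^ a i * G (g i) t (a i) p else 0) = 0"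
      by simp
  qed
  \<comment> \<open>The ring element \<open>(-1) ^ k\<close> is \<open>1\<close> or
    \<open>- 1\<close> and hence acts on coefficients as a sign.\<close>
  moreover have "mds_coeff ((-1) ^ k * S) n = (-1) ^ k * mds_coeff S n" for k
    by (cases "even k") simp_all
  ultimately show ?thesis
    unfolding formal_Delta_factor_def S_def[symmetric] by simp
qed

lemma restr_Delta_factor_nonmember:
  assumes "prime p" "p \<notin> P"
  shows "restr P (formal_Delta_factor g t p :: 'r::finite mds) = 1"
proof (rule mds_eqI)
  fix n :: "'r \<Rightarrow> nat"
  show "mds_coeff (restr P (formal_Delta_factor g t p)) n = mds_coeff 1 n"
  proof (cases "\<forall>i. n i \<in> smooth P")
    case True
    \<comment> \<open>\<open>undefined\<close> stands for an arbitrary coordinate: one entry prime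
      to \<open>p\<close> suffices.\<close>
    then have "\<not> p dvd n undefined" using assms by (auto simp: smooth_def)
    then show ?thesis using True mds_coeff_Delta_factor_eq_one[OF _ assms(1)] by (simp add: mds_coeff_restr)
  next
    case False
    then have "mds_coeff 1 n = 0" unfolding mds_coeff_one by (metis one_in_smooth(1))
    with False show ?thesis by (auto simp: mds_coeff_restr)
  qed
qed

lemma restr_restr: "P \<subseteq> Q \<Longrightarrow> restr P (restr Q F) = restr P F"
  by (rule mds_eqI) (use smooth_mono[of P Q] in \<open>auto simp: mds_coeff_restr\<close>)

text \<open>Factors at primes outside \<open>P\<close> restrict to \<open>1\<close>, so coefficients
  at \<open>P\<close>-smooth tuples stop changing once the partial product contains
  \<open>P\<close>.\<close>

lemma restr_prod_Delta_factor:
  assumes "P \<subseteq> S" "finite S" "\<And>p. p \<in> S \<Longrightarrow> prime p"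
  shows "restr P (\<Prod>p\<in>S. formal_Delta_factor g t p) = restr P (\<Prod>p\<in>P. formal_Delta_factor g t p)"
  unfolding restr_prod by (rule prod.mono_neutral_right) (use assms in \<open>auto intro!: restr_Delta_factor_nonmember\<close>)

text \<open>Supplies the finite set of primes on which the coefficient at \<open>n\<close>
  depends.\<close>

lemma smooth_prime_divisors:
  fixes n :: "'r::finite \<Rightarrow> nat"
  assumes "\<And>i. n i \<ge> 1"
  shows "finite {q. prime q \<and> (\<exists>i. q dvd n i)}" "n i \<in> smooth {q. prime q \<and> (\<exists>i. q dvd n i)}"
proof -
  have "{q. prime q \<and> (\<exists>i. q dvd n i)} \<subseteq> (\<Union>i. {d. d dvd n i})" by auto
  moreover have "finite (\<Union>i. {d. d dvd n i})" using assms by (auto simp: Suc_le_eq)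
  ultimately show "finite {q. prime q \<and> (\<exists>i. q dvd n i)}" by (rule finite_subset)
  show "n i \<in> smooth {q. prime q \<and> (\<exists>i. q dvd n i)}" using assms by (auto simp: smooth_def)
qed

text \<open>The coefficient at \<open>n\<close> is stable from \<open>Q n\<close>, the primes
  dividing some entry of \<open>n\<close>, onwards; the witness reads each coefficient off at that
  stage.\<close>

lemma formally_multipliable_Delta_factor:
  fixes g :: "'r::finite \<Rightarrow> nat \<Rightarrow> nat \<Rightarrow> complex"
  shows "formally_multipliable (formal_Delta_factor g t) {p. prime p}"
proof -
  define Q where "Q = (\<lambda>n :: 'r \<Rightarrow> nat. {q. prime q \<and> (\<exists>i. q dvd n i)})"
  have "has_formal_prod (formal_Delta_factor g t) {p. prime p} (Mds (\<lambda>n. mds_coeff (\<Prod>p\<in>Q n. formal_Delta_factor g t p) n))"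
    unfolding has_formal_prod_def
  proof (rule allI)
    fix n :: "'r \<Rightarrow> nat"
    show "\<forall>\<^sub>F S in finite_subsets_at_top {p. prime p}. mds_coeff (\<Prod>p\<in>S. formal_Delta_factor g t p) n =
        mds_coeff (Mds (\<lambda>n. mds_coeff (\<Prod>p\<in>Q n. formal_Delta_factor g t p) n)) n"
    proof (cases "\<forall>i. n i \<ge> 1")
      case False
      then have "\<exists>i. n i = 0" by (metis less_one not_le)
      then show ?thesis by (simp add: mds_coeff_nonpos)
    next
      case True
      then have Q: "finite (Q n)" "\<And>i. n i \<in> smooth (Q n)"
        unfolding Q_def using smooth_prime_divisors[of n] by blast+
      show ?thesis unfolding eventually_finite_subsets_at_top
      proof (intro exI[of _ "Q n"] conjI allI impI)
        fix S assume S: "finite S \<and> Q n \<subseteq> S \<and> S \<subseteq> {p. prime p}"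
        have "mds_coeff (restr (Q n) (\<Prod>p\<in>S. formal_Delta_factor g t p)) n =
              mds_coeff (restr (Q n) (\<Prod>p\<in>Q n. formal_Delta_factor g t p)) n"
          by (subst restr_prod_Delta_factor[of "Q n" S]) (use S in auto)
        then show "mds_coeff (\<Prod>p\<in>S. formal_Delta_factor g t p) n =
            mds_coeff (Mds (\<lambda>n. mds_coeff (\<Prod>p\<in>Q n. formal_Delta_factor g t p) n)) n"
          using Q True by (simp add: mds_coeff_restr mds_coeff_Mds)
      qed (use Q in \<open>auto simp: Q_def\<close>)
    qed
  qed
  then show ?thesis unfolding formally_multipliable_def by blast
qed

text \<open>At a given \<open>n\<close> the infinite product agrees with every finite one over
  primes containing some \<open>X\<close>. Take \<open>X \<union> P\<close>; restriction to
  \<open>P\<close> then discards the primes outside \<open>P\<close>.\<close>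

lemma restr_formal_Delta:
  fixes g :: "'r::finite \<Rightarrow> nat \<Rightarrow> nat \<Rightarrow> complex"
  assumes P: "finite P" "\<And>p. p \<in> P \<Longrightarrow> prime p"
  shows "restr P (formal_Delta g t) = restr P (\<Prod>p\<in>P. formal_Delta_factor g t p)"
proof (rule mds_eqI)
  fix n :: "'r \<Rightarrow> nat"
  have "\<forall>\<^sub>F S in finite_subsets_at_top {p. prime p}. mds_coeff (\<Prod>p\<in>S. formal_Delta_factor g t p) n = mds_coeff (formal_Delta g t) n"
    using has_formal_prod_formal_prod[OF formally_multipliable_Delta_factor[of g t]]
    unfolding has_formal_prod_def formal_Delta_def by blast
  then obtain X where X: "finite X" "X \<subseteq> {p. prime p}"
    and *: "\<And>S. finite S \<and> X \<subseteq> S \<and> S \<subseteq> {p. prime p} \<Longrightarrow> mds_coeff (\<Prod>p\<in>S. formal_Delta_factor g t p) n = mds_coeff (formal_Delta g t) n"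
    unfolding eventually_finite_subsets_at_top by blast
  have "mds_coeff (\<Prod>p\<in>X \<union> P. formal_Delta_factor g t p) n = mds_coeff (formal_Delta g t) n"
    by (rule *) (use X P in auto)
  moreover have "restr P (\<Prod>p\<in>X \<union> P. formal_Delta_factor g t p) = restr P (\<Prod>p\<in>P. formal_Delta_factor g t p)"
    by (rule restr_prod_Delta_factor) (use X P in auto)
  ultimately show "mds_coeff (restr P (formal_Delta g t)) n = mds_coeff (restr P (\<Prod>p\<in>P. formal_Delta_factor g t p)) n"
    by (metis mds_coeff_restr)
qed

lemma (in convolved_functions) formal_identity:
  "formal_coprime_series f = (\<Prod>i\<in>UNIV. formal_D (f i) i) * formal_Delta g t"
proof (rule mds_eqI)
  fix n :: "'r \<Rightarrow> nat" assume n: "\<And>i. n i \<ge> 1"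
  define P where "P = {q. prime q \<and> (\<exists>i. q dvd n i)}"
  have P: "finite P" "\<And>i. n i \<in> smooth P" "\<And>p. p \<in> P \<Longrightarrow> prime p"
    unfolding P_def using smooth_prime_divisors[of n] n by blast+
  \<comment> \<open>The Euler factors in \<open>smooth_identity\<close> are unrestricted; the second
    restriction also covers them, so that they can be matched with
    \<open>restr P (formal_Delta g t)\<close>.\<close>
  have "restr P (formal_coprime_series f) = restr P (restr P (formal_coprime_series f))"
    by (simp add: restr_restr)
  also have "\<dots> = restr P ((\<Prod>i\<in>UNIV. formal_D (f i) i) * formal_Delta g t)"
    by (simp add: smooth_identity[OF P(1,3)] restr_times restr_restr restr_formal_Delta[OF P(1,3)])
  finally have "mds_coeff (restr P (formal_coprime_series f)) n =
      mds_coeff (restr P ((\<Prod>i\<in>UNIV. formal_D (f i) i) * formal_Delta g t)) n" by simp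
  with P(2) show "mds_coeff (formal_coprime_series f) n = mds_coeff ((\<Prod>i\<in>UNIV. formal_D (f i) i) * formal_Delta g t) n"
    by (simp add: mds_coeff_restr)
qed

section \<open>Evaluation at a point of absolute convergence\<close>

definition mds_term :: "('r::finite \<Rightarrow> complex) \<Rightarrow> 'r mds \<Rightarrow> ('r \<Rightarrow> nat) \<Rightarrow> complex" where
  "mds_term s F n = mds_coeff F n / (\<Prod>i\<in>UNIV. of_nat (n i) powr s i)"

text \<open>A relation joining absolute convergence and value, so that the rules for sums and
  products carry both along at once.\<close>

definition mds_abs_sums :: "('r::finite \<Rightarrow> complex) \<Rightarrow> 'r mds \<Rightarrow> complex \<Rightarrow> bool" where
  "mds_abs_sums s F v \<longleftrightarrow> (\<lambda>n. norm (mds_term s F n)) summable_on UNIV \<and> (mds_term s F has_sum v) UNIV"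

lemma mds_abs_sums_unique: "mds_abs_sums s F v \<Longrightarrow> mds_abs_sums s F w \<Longrightarrow> v = w"
  unfolding mds_abs_sums_def by (blast intro: has_sum_unique)

lemma mds_abs_sums_summable:
  assumes "(\<lambda>n. norm (mds_term s F n)) summable_on UNIV"
  shows "mds_abs_sums s F (infsum (mds_term s F) UNIV)"
  using assms abs_summable_summable[OF assms] by (simp add: mds_abs_sums_def)

lemma mds_term_eq_0: "\<not> (\<forall>i. n i \<ge> 1) \<Longrightarrow> mds_term s F n = 0"
  unfolding mds_term_def by (metis mds_coeff_nonpos less_one not_le div_0)

lemma mds_term_add: "mds_term s (F + H) = (\<lambda>n. mds_term s F n + mds_term s H n)"
  by (rule ext) (simp add: mds_term_def add_divide_distrib)

lemma mds_abs_sums_add: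
  assumes "mds_abs_sums s F v" "mds_abs_sums s H w"
  shows "mds_abs_sums s (F + H) (v + w)"
proof -
  have "(\<lambda>n. norm (mds_term s F n) + norm (mds_term s H n)) summable_on UNIV"
    using assms by (auto simp: mds_abs_sums_def intro: summable_on_add)
  then have "(\<lambda>n. norm (mds_term s F n + mds_term s H n)) summable_on UNIV"
    by (rule Infinite_Sum.abs_summable_on_comparison_test') (rule norm_triangle_ineq)
  moreover have "((\<lambda>n. mds_term s F n + mds_term s H n) has_sum (v + w)) UNIV"
    using assms by (auto simp: mds_abs_sums_def intro: has_sum_add)
  ultimately show ?thesis unfolding mds_abs_sums_def mds_term_add by blast
qed

lemma mds_abs_sums_uminus: "mds_abs_sums s F v \<Longrightarrow> mds_abs_sums s (- F) (- v)"
  by (simp add: mds_abs_sums_def mds_term_def[abs_def] has_sum_uminus)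

lemma mds_abs_sums_zero: "mds_abs_sums s 0 0"
  by (simp add: mds_abs_sums_def mds_term_def[abs_def])

lemma mds_abs_sums_monom:
  assumes "\<And>i. m i \<ge> 1"
  shows "mds_abs_sums s (mds_monom m c) (c / (\<Prod>i\<in>UNIV. of_nat (m i) powr s i))"
proof -
  have *: "mds_term s (mds_monom m c) n = 0" if "n \<noteq> m" for n
    using that by (simp add: mds_term_def mds_coeff_monom)
  have **: "mds_term s (mds_monom m c) m = c / (\<Prod>i\<in>UNIV. of_nat (m i) powr s i)"
    using assms by (simp add: mds_term_def mds_coeff_monom)
  have "((\<lambda>n. norm (mds_term s (mds_monom m c) n)) has_sum norm (mds_term s (mds_monom m c) m)) UNIV"
    by (rule has_sum_finite_neutralI[of "{m}"]) (auto simp: *)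
  moreover have "(mds_term s (mds_monom m c) has_sum mds_term s (mds_monom m c) m) UNIV"
    by (rule has_sum_finite_neutralI[of "{m}"]) (auto simp: *)
  ultimately show ?thesis unfolding mds_abs_sums_def ** by (blast intro: has_sum_imp_summable)
qed

lemma mds_abs_sums_one: "mds_abs_sums s 1 1"
  using mds_abs_sums_monom[of "\<lambda>_. 1" s 1] unfolding mds_monom_one by simp

lemma mds_abs_sums_sum:
  "(\<And>x. x \<in> A \<Longrightarrow> mds_abs_sums s (F x) (v x)) \<Longrightarrow> mds_abs_sums s (\<Sum>x\<in>A. F x) (\<Sum>x\<in>A. v x)"
  by (induction A rule: infinite_finite_induct) (auto intro: mds_abs_sums_add mds_abs_sums_zero)

section \<open>Multiplicativity of evaluation\<close>

text \<open>Fubini: the norms are summable over the product set, so the double sum may be computed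
  as an iterated one.\<close>

lemma has_sum_times:
  fixes u :: "'a \<Rightarrow> 'c::{banach,real_normed_field}" and v :: "'b \<Rightarrow> 'c"
  assumes "(\<lambda>x. norm (u x)) summable_on A" "(u has_sum a) A"
    and "(\<lambda>y. norm (v y)) summable_on B" "(v has_sum b) B"
  shows "(\<lambda>(x, y). norm (u x) * norm (v y)) summable_on A \<times> B"
    and "((\<lambda>(x, y). u x * v y) has_sum (a * b)) (A \<times> B)"
proof -
  obtain b' where "((\<lambda>y. norm (v y)) has_sum b') B" using assms(3) by (auto simp: summable_on_def)
  then have "((\<lambda>y. norm (u x) * norm (v y)) has_sum (norm (u x) * b')) B" for x
    by (rule has_sum_cmult_right)
  then show abs: "(\<lambda>(x, y). norm (u x) * norm (v y)) summable_on A \<times> B"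
    by (intro summable_on_SigmaI[where g = "\<lambda>x. norm (u x) * b'"] summable_on_cmult_left assms(1)) auto
  have "(\<lambda>z. norm (case z of (x, y) \<Rightarrow> u x * v y)) summable_on A \<times> B"
    using abs by (simp add: case_prod_unfold norm_mult)
  then have "(\<lambda>(x, y). u x * v y) summable_on A \<times> B" by (rule abs_summable_summable)
  then show "((\<lambda>(x, y). u x * v y) has_sum (a * b)) (A \<times> B)"
    by (intro has_sum_SigmaI[where g = "\<lambda>x. u x * b"] has_sum_cmult_left[OF assms(2)])
       (simp_all add: has_sum_cmult_right[OF assms(4)])
qed

text \<open>The weights \<open>of_nat (n i) powr s i\<close> are multiplicative because the bases
  are nonnegative reals, where complex powers respect products.\<close>

lemma mds_term_times:
  fixes F H :: "'r::finite mds"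
  assumes "\<And>i. n i \<ge> 1"
  shows "mds_term s (F * H) n = (\<Sum>(d, e)\<in>mult_pairs n. mds_term s F d * mds_term s H e)"
proof -
  have "mds_coeff F d * mds_coeff H e / (\<Prod>i\<in>UNIV. of_nat (n i) powr s i) = mds_term s F d * mds_term s H e"
    if n: "(\<lambda>i. d i * e i) = n" for d e
  proof -
    have "of_nat (n i) powr s i = of_nat (d i) powr s i * of_nat (e i) powr s i" for i
      using n by (auto simp: powr_times_real)
    then show ?thesis by (simp add: mds_term_def prod.distrib)
  qed
  then show ?thesis
    unfolding mds_term_def[of s "F * H"] mds_coeff_times[OF assms] sum_divide_distrib
    by (intro sum.cong) auto
qed

text \<open>Groups a sum over pairs by their entrywise product; over positive tuples the fibres are
  finite. The general target type covers both the complex terms and their real norms.\<close>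

lemma has_sum_mult_pairs:
  fixes c :: "('r::finite \<Rightarrow> nat) \<times> ('r \<Rightarrow> nat) \<Rightarrow> 'c::{topological_comm_monoid_add,t3_space}"
  assumes "(c has_sum v) UNIV" "\<And>d e i. d i = 0 \<or> e i = 0 \<Longrightarrow> c (d, e) = 0"
  shows "((\<lambda>n. \<Sum>x\<in>mult_pairs n. c x) has_sum v) {n. \<forall>i. n i \<ge> 1}"
proof -
  define T where "T = {n :: 'r \<Rightarrow> nat. \<forall>i. n i \<ge> 1}"
  have "(c has_sum v) (T \<times> T)"
  proof (subst has_sum_cong_neutral[where T = UNIV and g = c])
    fix x assume x: "x \<in> UNIV - T \<times> T"
    obtain d e where de: "x = (d, e)" by (cases x)
    with x obtain i where "d i = 0 \<or> e i = 0" by (auto simp: T_def Suc_le_eq)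
    with assms(2) show "c x = 0" unfolding de by blast
  qed (use assms(1) in auto)
  \<comment> \<open>Each pair lies in exactly one fibre, the one over its entrywise product.\<close>
  also have "?this \<longleftrightarrow> ((\<lambda>(n, x). c x) has_sum v) (Sigma T mult_pairs)"
    by (rule has_sum_reindex_bij_witness[of _ snd "\<lambda>(d, e). ((\<lambda>i. d i * e i), (d, e))"])
       (auto simp: T_def Suc_le_eq)
  finally have "((\<lambda>(n, x). c x) has_sum v) (Sigma T mult_pairs)" .
  then have "((\<lambda>n. \<Sum>x\<in>mult_pairs n. c x) has_sum v) T"
    by (rule has_sum_SigmaD) (auto simp: T_def intro!: has_sum_finite finite_mult_pairs)
  then show ?thesis by (simp add: T_def)
qed

text \<open>The double series of all products of terms converges absolutely and is regrouped by
  \<open>n\<close>. The same regrouping of the norms dominates the terms of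
  \<open>F * H\<close>.\<close>

lemma mds_abs_sums_times:
  fixes F H :: "'r::finite mds"
  assumes "mds_abs_sums s F v" "mds_abs_sums s H w"
  shows "mds_abs_sums s (F * H) (v * w)"
proof -
  define T where "T = {n :: 'r \<Rightarrow> nat. \<forall>i. n i \<ge> 1}"
  define c where "c = (\<lambda>(d, e). mds_term s F d * mds_term s H e)"
  have 1: "(\<lambda>x. norm (c x)) summable_on UNIV" and 2: "(c has_sum (v * w)) UNIV"
    using assms has_sum_times[of "mds_term s F" UNIV v "mds_term s H" UNIV w]
    by (simp_all add: mds_abs_sums_def c_def case_prod_unfold norm_mult)
  have c0: "c (d, e) = 0" if "d i = 0 \<or> e i = 0" for d e i
  proof -
    have "mds_coeff F d = 0 \<or> mds_coeff H e = 0" using that mds_coeff_nonpos by blast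
    then show ?thesis by (auto simp: c_def mds_term_def)
  qed
  have eq: "mds_term s (F * H) n = (\<Sum>x\<in>mult_pairs n. c x)" if "n \<in> T" for n
    using mds_term_times[of n s F H] that by (simp add: T_def c_def)
  have "((\<lambda>n. \<Sum>x\<in>mult_pairs n. c x) has_sum (v * w)) T"
    unfolding T_def using 2 c0 by (rule has_sum_mult_pairs)
  then have "(mds_term s (F * H) has_sum (v * w)) T"
    by (subst has_sum_cong[OF eq])
  then have sums: "(mds_term s (F * H) has_sum (v * w)) UNIV"
    by (subst has_sum_cong_neutral[where T = T and g = "mds_term s (F * H)"]) (auto simp: T_def mds_term_eq_0)
  obtain u where "((\<lambda>x. norm (c x)) has_sum u) UNIV" using 1 by (auto simp: summable_on_def)
  then have "((\<lambda>n. \<Sum>x\<in>mult_pairs n. norm (c x)) has_sum u) T"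
    unfolding T_def by (rule has_sum_mult_pairs) (simp add: c0)
  then have "(\<lambda>n. \<Sum>x\<in>mult_pairs n. norm (c x)) summable_on T"
    by (rule has_sum_imp_summable)
  then have "(\<lambda>n. norm (mds_term s (F * H) n)) summable_on T"
    by (rule Infinite_Sum.abs_summable_on_comparison_test') (simp only: eq norm_sum)
  then have "(\<lambda>n. norm (mds_term s (F * H) n)) summable_on UNIV"
    by (subst summable_on_cong_neutral[where T = T and g = "\<lambda>n. norm (mds_term s (F * H) n)"]) (auto simp: T_def mds_term_eq_0)
  with sums show ?thesis by (simp add: mds_abs_sums_def)
qed

lemma mds_abs_sums_prod:
  "(\<And>x. x \<in> A \<Longrightarrow> mds_abs_sums s (F x) (v x)) \<Longrightarrow> mds_abs_sums s (\<Prod>x\<in>A. F x) (\<Prod>x\<in>A. v x)"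
  by (induction A rule: infinite_finite_induct) (auto intro: mds_abs_sums_times mds_abs_sums_one)

lemma mds_abs_sums_power: "mds_abs_sums s F v \<Longrightarrow> mds_abs_sums s (F ^ k) (v ^ k)"
  by (induction k) (auto intro: mds_abs_sums_times mds_abs_sums_one)

text \<open>An Euler factor is a finite combination of monomials and so has a value at every
  \<open>s\<close>.\<close>

lemma mds_abs_sums_Delta_factor:
  fixes g :: "'r::finite \<Rightarrow> nat \<Rightarrow> nat \<Rightarrow> complex"
  assumes p: "prime p"
  shows "mds_abs_sums s (formal_Delta_factor g t p) (Delta_factor g t s p)"
proof -
  have p0: "of_nat p \<noteq> (0 :: complex)" and p1: "p \<ge> 1" using p prime_gt_0_nat[of p] by auto
  have "mds_abs_sums s (mds_monom (\<lambda>i. p ^ a i) c) (1 / of_nat p powr (\<Sum>i\<in>UNIV. of_nat (a i) * s i) * c)" for a c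
  proof -
    \<comment> \<open>For natural \<open>k\<close> this follows by induction from multiplicativity
      in the base; it merges the separate powers into the single exponent in
      \<open>Delta_factor\<close>.\<close>
    have "of_nat p powr (of_nat k * z) = of_nat (p ^ k) powr z" for k and z :: complex
    proof (induction k)
      case (Suc k)
      have "of_nat (p ^ Suc k) powr z = of_nat p powr z * of_nat (p ^ k) powr z"
        by (simp add: powr_times_real)
      with Suc show ?case by (simp add: powr_add distrib_right)
    qed (use p0 in simp)
    then have "(\<Prod>i\<in>UNIV. of_nat (p ^ a i) powr s i) = of_nat p powr (\<Sum>i\<in>UNIV. of_nat (a i) * s i)"
      using p0 by (simp only: powr_sum not_False_eq_True)
    then show ?thesis using mds_abs_sums_monom[of "\<lambda>i. p ^ a i" s c] p1 by simp
  qed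
  then show ?thesis
    unfolding formal_Delta_factor_def Delta_factor_def
    by (intro mds_abs_sums_add mds_abs_sums_one mds_abs_sums_times mds_abs_sums_power
          mds_abs_sums_uminus mds_abs_sums_sum)
qed

section \<open>Values of the one-variable series and of the coprime series\<close>

lemma has_sum_single_index:
  fixes h :: "nat \<Rightarrow> 'c::{topological_comm_monoid_add,t2_space}" and i :: 'r
  shows "((\<lambda>n. h (n i)) has_sum v) {n. (\<forall>k. k \<noteq> i \<longrightarrow> n k = 1) \<and> n i \<ge> (1::nat)} \<longleftrightarrow> (h has_sum v) {1..}"
  by (rule has_sum_reindex_bij_witness[of _ "\<lambda>n k. if k = i then n else 1" "\<lambda>n. n i"]) auto

lemma mds_abs_sums_formal_D:
  assumes "(\<lambda>n. norm (D_term f (s i) n)) summable_on {1..}"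
  shows "mds_abs_sums s (formal_D f i) (D f (s i))"
proof -
  define T where "T = {n. (\<forall>k. k \<noteq> i \<longrightarrow> n k = 1) \<and> n i \<ge> (1::nat)}"
  have 0: "mds_term s (formal_D f i) n = 0" if "n \<notin> T" for n
    using that by (auto simp: mds_term_def mds_coeff_formal_D T_def)
  have 1: "mds_term s (formal_D f i) n = D_term f (s i) (n i)" if "n \<in> T" for n
  proof -
    have "(\<Prod>k\<in>UNIV. of_nat (n k) powr s k) = (\<Prod>k\<in>UNIV. if k = i then of_nat (n i) powr s i else 1)"
      by (rule prod.cong) (use that in \<open>auto simp: T_def\<close>)
    then show ?thesis using that by (simp add: mds_term_def mds_coeff_formal_D D_term_def T_def)
  qed
  have "(D_term f (s i) has_sum D f (s i)) {1..}"
    unfolding D_def by (rule has_sum_infsum, rule abs_summable_summable, rule assms)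
  then have "((\<lambda>n. D_term f (s i) (n i)) has_sum D f (s i)) T"
    unfolding T_def by (simp only: has_sum_single_index)
  then have "(mds_term s (formal_D f i) has_sum D f (s i)) UNIV"
    by (subst has_sum_cong_neutral[where T = T and g = "\<lambda>n. D_term f (s i) (n i)"]) (auto simp: 0 1)
  moreover obtain u where "((\<lambda>n. norm (D_term f (s i) n)) has_sum u) {1..}"
    using assms by (auto simp: summable_on_def)
  then have "((\<lambda>n. norm (D_term f (s i) (n i))) has_sum u) T"
    unfolding T_def by (simp only: has_sum_single_index[of "\<lambda>n. norm (D_term f (s i) n)"])
  then have "((\<lambda>n. norm (mds_term s (formal_D f i) n)) has_sum u) UNIV"
    by (subst has_sum_cong_neutral[where T = T and g = "\<lambda>n. norm (D_term f (s i) (n i))"]) (auto simp: 0 1)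
  ultimately show ?thesis unfolding mds_abs_sums_def by (blast intro: has_sum_imp_summable)
qed

lemma (in convolved_functions) mds_abs_sums_coprime_series:
  assumes "(\<lambda>n. norm (multi_term f s n)) summable_on coprime_tuples"
  shows "mds_abs_sums s (formal_coprime_series f) (\<Sum>\<^sub>\<infinity>n\<in>coprime_tuples. multi_term f s n)"
proof -
  have eq: "mds_term s (formal_coprime_series f) n = (if n \<in> coprime_tuples then multi_term f s n else 0)" for n
    by (simp add: mds_term_def mds_coeff_coprime_series multi_term_def)
  have "(multi_term f s has_sum (\<Sum>\<^sub>\<infinity>n\<in>coprime_tuples. multi_term f s n)) coprime_tuples"
    by (rule has_sum_infsum, rule abs_summable_summable, rule assms)
  then have "(mds_term s (formal_coprime_series f) has_sum (\<Sum>\<^sub>\<infinity>n\<in>coprime_tuples. multi_term f s n)) UNIV"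
    by (subst has_sum_cong_neutral[where T = coprime_tuples and g = "multi_term f s"]) (auto simp: eq)
  moreover have "(\<lambda>n. norm (mds_term s (formal_coprime_series f) n)) summable_on UNIV"
    using assms by (subst summable_on_cong_neutral[where T = coprime_tuples and g = "\<lambda>n. norm (multi_term f s n)"]) (auto simp: eq)
  ultimately show ?thesis by (simp add: mds_abs_sums_def)
qed

section \<open>Passage to the limit over the primes up to \<open>N\<close>\<close>

lemma mds_abs_sums_restr:
  assumes "mds_abs_sums s F v"
  shows "mds_abs_sums s (restr P F) (infsum (mds_term s (restr P F)) UNIV)"
proof (rule mds_abs_sums_summable)
  have "(\<lambda>n. norm (mds_term s F n)) summable_on UNIV" using assms by (simp add: mds_abs_sums_def)
  then show "(\<lambda>n. norm (mds_term s (restr P F) n)) summable_on UNIV"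
    by (rule Infinite_Sum.abs_summable_on_comparison_test') (simp add: mds_term_def mds_coeff_restr)
qed

text \<open>A finite set \<open>X\<close> of tuples carries all but \<open>e / 2\<close> of the
  absolute sum. Once \<open>N\<close> bounds the entries in \<open>X\<close>, every positive tuple
  in \<open>X\<close> survives the restriction, so the error is bounded by the tail.\<close>

lemma restr_tendsto:
  fixes F :: "'r::finite mds"
  assumes F: "mds_abs_sums s F v"
  shows "(\<lambda>N. infsum (mds_term s (restr {p. prime p \<and> p \<le> N} F)) UNIV) \<longlonglongrightarrow> v"
proof (rule LIMSEQ_I)
  fix e :: real assume e: "e > 0"
  define R where "R = (\<lambda>N. restr {p. prime p \<and> p \<le> N} F)"
  define u where "u = infsum (\<lambda>n. norm (mds_term s F n)) UNIV"
  have u: "((\<lambda>n. norm (mds_term s F n)) has_sum u) UNIV"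
    using F by (simp add: mds_abs_sums_def u_def)
  from has_sum_finite_approximation[OF u, of "e / 2"] e
  obtain X where X: "finite X" "dist (\<Sum>n\<in>X. norm (mds_term s F n)) u \<le> e / 2" by auto
  \<comment> \<open>A crude bound for every entry of every tuple in \<open>X\<close>, and hence for
    the primes dividing the positive ones.\<close>
  define N0 where "N0 = (\<Sum>n\<in>X. \<Sum>i\<in>UNIV. n i)"
  have N0: "n i \<le> N0" if "n \<in> X" for n i
  proof -
    have "n i \<le> (\<Sum>i\<in>UNIV. n i)" by (rule member_le_sum) auto
    also have "\<dots> \<le> N0" unfolding N0_def by (rule member_le_sum[OF that]) (use X in auto)
    finally show ?thesis .
  qed
  show "\<exists>N0. \<forall>N\<ge>N0. norm (infsum (mds_term s (R N)) UNIV - v) < e"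
  proof (intro exI[of _ N0] allI impI)
    fix N assume N: "N \<ge> N0"
    \<comment> \<open>The terms of \<open>F - R N\<close>; this keeps the terms of \<open>F\<close>
      only at the tuples removed by the restriction.\<close>
    define h where "h = (\<lambda>n. mds_term s F n + mds_term s (- R N) n)"
    have h: "h n = (if \<forall>i. n i \<in> smooth {p. prime p \<and> p \<le> N} then 0 else mds_term s F n)" for n
      by (auto simp: h_def mds_term_def R_def mds_coeff_restr)
    have "mds_abs_sums s (F + - R N) (v + - infsum (mds_term s (R N)) UNIV)"
      unfolding R_def by (intro mds_abs_sums_add mds_abs_sums_uminus mds_abs_sums_restr[OF F] F)
    then have hs: "(h has_sum (v + - infsum (mds_term s (R N)) UNIV)) UNIV" "(\<lambda>n. norm (h n)) summable_on UNIV"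
      unfolding mds_abs_sums_def mds_term_add h_def by blast+
    have hX: "h n = 0" if "n \<in> X" for n
    proof (cases "\<forall>i. n i \<ge> 1")
      case True
      have "n i \<in> smooth {p. prime p \<and> p \<le> N}" for i
        using True N0[OF that, of i] N by (auto simp: smooth_def Suc_le_eq dest!: dvd_imp_le)
      then show ?thesis by (simp add: h)
    qed (simp add: h mds_term_eq_0)
    have tail: "((\<lambda>n. norm (mds_term s F n)) has_sum (u - (\<Sum>n\<in>X. norm (mds_term s F n)))) (UNIV - X)"
      by (rule has_sum_Diff[OF u has_sum_finite]) (use X in auto)
    have "norm (h n) \<le> norm (mds_term s F n)" for n by (simp add: h)
    \<comment> \<open>\<open>h\<close> vanishes on \<open>X\<close>, so its whole absolute sum is
      dominated by the tail outside \<open>X\<close>.\<close>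
    then have "infsum (\<lambda>n. norm (h n)) UNIV \<le> u - (\<Sum>n\<in>X. norm (mds_term s F n))"
      by (rule has_sum_mono_neutral[OF has_sum_infsum[OF hs(2)] tail]) (auto simp: hX)
    also have "\<dots> \<le> e / 2" using X(2) unfolding dist_real_def abs_le_iff by linarith
    also have "\<dots> < e" using e by simp
    finally have "norm (v + - infsum (mds_term s (R N)) UNIV) < e"
      using norm_has_sum_bound[OF has_sum_infsum[OF hs(2)] hs(1)] by linarith
    then show "norm (infsum (mds_term s (R N)) UNIV - v) < e" by (simp add: norm_minus_commute)
  qed
qed

lemma (in convolved_functions) analytic_identity:
  assumes C: "(\<lambda>n. norm (multi_term f s n)) summable_on coprime_tuples"
    and D: "\<And>i. (\<lambda>n. norm (D_term (f i) (s i) n)) summable_on {1..}"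
    and Delta: "abs_convergent_prod (Delta_seq g t s)"
  shows "(\<Sum>\<^sub>\<infinity>n\<in>coprime_tuples. multi_term f s n) = (\<Prod>i\<in>UNIV. D (f i) (s i)) * Delta g t s"
proof -
  define P where "P = (\<lambda>N::nat. {p. prime p \<and> p \<le> N})"
  define CF where "CF = formal_coprime_series f"
  define DF where "DF = (\<Prod>i\<in>UNIV. formal_D (f i) i)"
  have CF: "mds_abs_sums s CF (\<Sum>\<^sub>\<infinity>n\<in>coprime_tuples. multi_term f s n)"
    unfolding CF_def by (rule mds_abs_sums_coprime_series) (rule C)
  have DF: "mds_abs_sums s DF (\<Prod>i\<in>UNIV. D (f i) (s i))"
    unfolding DF_def by (intro mds_abs_sums_prod mds_abs_sums_formal_D D)
  have eq: "infsum (mds_term s (restr (P N) CF)) UNIV =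
            infsum (mds_term s (restr (P N) DF)) UNIV * (\<Prod>p\<le>N. Delta_seq g t s p)" for N
  proof -
    have fin: "finite (P N)" by (auto simp: P_def)
    have "mds_abs_sums s (restr (P N) DF * (\<Prod>p\<in>P N. formal_Delta_factor g t p))
            (infsum (mds_term s (restr (P N) DF)) UNIV * (\<Prod>p\<in>P N. Delta_factor g t s p))"
      by (intro mds_abs_sums_times mds_abs_sums_restr[OF DF] mds_abs_sums_prod mds_abs_sums_Delta_factor)
         (simp add: P_def)
    \<comment> \<open>The formal identity says that the product just evaluated is the restricted
      coprime series; uniqueness of values then gives a numerical identity.\<close>
    also have "restr (P N) DF * (\<Prod>p\<in>P N. formal_Delta_factor g t p) = restr (P N) CF"
      unfolding CF_def DF_def by (rule smooth_identity[symmetric, OF fin]) (simp add: P_def)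
    finally have "infsum (mds_term s (restr (P N) CF)) UNIV =
        infsum (mds_term s (restr (P N) DF)) UNIV * (\<Prod>p\<in>P N. Delta_factor g t s p)"
      by (rule mds_abs_sums_unique[OF mds_abs_sums_restr[OF CF]])
    \<comment> \<open>\<open>Delta_seq\<close> is \<open>1\<close> at nonprimes, \<open>0\<close>
      and \<open>1\<close> included, which turns the product over primes into a partial product of
      \<open>prodinf\<close>, whose index starts at \<open>0\<close>.\<close>
    also have "(\<Prod>p\<in>P N. Delta_factor g t s p) = (\<Prod>p\<le>N. Delta_seq g t s p)"
      by (rule prod.mono_neutral_cong_left) (auto simp: P_def Delta_seq_def)
    finally show ?thesis .
  qed
  have "(\<lambda>N. \<Prod>p\<le>N. Delta_seq g t s p) \<longlonglongrightarrow> Delta g t s"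
    unfolding Delta_def by (intro convergent_prod_LIMSEQ abs_convergent_prod_imp_convergent_prod Delta)
  then have "(\<lambda>N. infsum (mds_term s (restr (P N) CF)) UNIV) \<longlonglongrightarrow> (\<Prod>i\<in>UNIV. D (f i) (s i)) * Delta g t s"
    unfolding eq using restr_tendsto[OF DF] unfolding P_def by (intro tendsto_mult)
  moreover have "(\<lambda>N. infsum (mds_term s (restr (P N) CF)) UNIV) \<longlonglongrightarrow> (\<Sum>\<^sub>\<infinity>n\<in>coprime_tuples. multi_term f s n)"
    unfolding P_def by (rule restr_tendsto[OF CF])
  ultimately show ?thesis by (rule LIMSEQ_unique[symmetric])
qed

theorem theorem2:
  fixes g :: "'r::finite \<Rightarrow> nat \<Rightarrow> nat \<Rightarrow> complex"
    and f :: "'r \<Rightarrow> nat \<Rightarrow> complex"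
    and t :: nat
  assumes "CARD('r) \<ge> 2" and "t \<ge> 1"
    and "\<And>i j. j \<in> {1..t} \<Longrightarrow> completely_multiplicative (g i j)"
    and "\<And>i n. n \<ge> 1 \<Longrightarrow> f i n = dirichlet_conv_upto (g i) t n"
  shows "(formally_multipliable (formal_Delta_factor g t) {p. prime p} \<and>
          formal_coprime_series f = (\<Prod>i\<in>UNIV. formal_D (f i) i) * formal_Delta g t) \<and>
         (\<forall>s :: 'r \<Rightarrow> complex.
            (\<lambda>n. norm (multi_term f s n)) summable_on coprime_tuples \<longrightarrow>
            (\<forall>i. (\<lambda>n. norm (D_term (f i) (s i) n)) summable_on {1..}) \<longrightarrow>
            abs_convergent_prod (Delta_seq g t s) \<longrightarrow>
            (\<Sum>\<^sub>\<infinity>n\<in>coprime_tuples. multi_term f s n) =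
              (\<Prod>i\<in>UNIV. D (f i) (s i)) * Delta g t s)"
proof -
  interpret convolved_functions g f t
    by unfold_locales (use assms in blast)+
  show ?thesis
    using formally_multipliable_Delta_factor formal_identity analytic_identity by blast
qed

end
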